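(* Let $L\subseteq L_\beta$ be a lattice of rank $n$, let $\mathcal B$ be an $r\times n$ integer matrix whose columns form a basis of $L$, and let $\mathcal A=(a_{ij})\in GL_r(\mathbb Z)$ and $\mathcal C\in GL_n(\mathbb Z)$ be unimodular matrices such that $\mathcal D=\mathcal A\mathcal B\mathcal C=[d_1\mathbf e_1|\cdots|d_n\mathbf e_n]$ is the Smith normal form of $\mathcal B$, where $\mathbf e_1,\dots,\mathbf e_n\in\mathbb Z^r$ are the first $n$ standard basis vectors and $d_1,\dots,d_n$ are positive integers with $d_i\mid d_{i+1}$ for $1\le i\le n-1$. Then the following hold. (i) For each $i\in\{1,\dots,n\}$ let $\eta_i$ be a generator of the cyclic group of $d_i$-th roots of unity in $\mathbb K$, and let $[P_i]=[\eta_i^{a_{i1}}:\cdots:\eta_i^{a_{ir}}]$. Then $$V_{X(\mathbb K)}(I_L)=\langle[P_1]\rangle\times\cdots\times\langle[P_n]\rangle$$ (internal direct product of cyclic subgroups of $T_X(\mathbb K)$). (ii) Suppose $\mathbb K=\mathbb F_q$ and $d_i$ divides $q-1$ for all $i\in\{1,\dots,n\}$. Let $Q$ be the $n\times r$ matrix whose $i$-th row is $[a_{i1}(q-1)/d_i\,|\,\cdots\,|\,a_{ir}(q-1)/d_i]$, i.e. $(q-1)/d_i$ times the $i$-th row of $\mathcal A$. Then $V_{X(\mathbb F_q)}(I_L)=Y_Q$.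
   Context: $\mathbb K$ is a field with algebraic closure $\overline{\mathbb K}$. $\Sigma$ is a complete simplicial fan in $\mathbb R^n$ with rays $\rho_1,\dots,\rho_r$ generated by primitive lattice vectors $\mathbf v_1,\dots,\mathbf v_r\in\mathbb Z^n$, and $X=X_\Sigma$ is the corresponding split toric variety over $\mathbb K$; its class group $\operatorname{Cl}X$ is assumed to be free. Let $\phi:\mathbb Z^n\to\mathbb Z^r$ be the $r\times n$ matrix with rows $\mathbf v_1,\dots,\mathbf v_r$, let $d=r-n$, and let $\beta:\mathbb Z^r\to\mathbb Z^d\cong \operatorname{Cl}X$ be an integer matrix such that $0\to\mathbb Z^n\xrightarrow{\phi}\mathbb Z^r\xrightarrow{\beta}\mathbb Z^d\to0$ is exact. $L_\beta=\operatorname{im}\phi=\ker\beta\subseteq\mathbb Z^r$, a lattice of rank $n$. The Cox ring $S=\mathbb K[x_1,\dots,x_r]$ is graded by $\deg x_j=\beta_j$, the $j$-th column of $\beta$; "homogeneous" refers to this grading. For a sublattice $L\subseteq L_\beta$, the lattice ideal is $I_L=\langle \mathbf x^{\mathbf m^+}-\mathbf x^{\mathbf m^-} : \mathbf m=\mathbf m^+-\mathbf m^-\in L\rangle\subseteq S$, where $\mathbf m^{\pm}\in\mathbb N^r$ are the positive and negative parts of $\mathbf m$. $B\subseteq S$ is the monomial ideal generated by $\prod_{\rho_i\not\subseteq\sigma}x_i$, $\sigma\in\Sigma$. $G=\{P\in(\overline{\mathbb K}^* )^r : \mathbf x^{\mathbf m}(P)=1 \text{ for all } \mathbf m\in L_\beta\}$,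 where $\mathbf x^{\mathbf a}(P)=p_1^{a_1}\cdots p_r^{a_r}$. $X(\mathbb K)$ is the set of orbits $[P]=[p_1:\cdots:p_r]=G\cdot P$ with $P\in\mathbb K^r\setminus V(B)$; $T_X(\mathbb K)$ is the group (under coordinatewise multiplication) of orbits $[P]$ with $P\in(\mathbb K^* )^r$. For a homogeneous ideal $J$, $V_{X(\mathbb K)}(J)=\{[P]\in X(\mathbb K): F(P)=0\text{ for all homogeneous }F\in J\}$; when $L\subseteq L_\beta$ has rank $n$, $V_{X(\mathbb K)}(I_L)$ is a subgroup of $T_X(\mathbb K)$. For an integer matrix $Q=[\mathbf q_1\,\cdots\,\mathbf q_r]$ of size $s\times r$ with columns $\mathbf q_j$, $Y_Q=\{[\mathbf t^{\mathbf q_1}:\cdots:\mathbf t^{\mathbf q_r}] : \mathbf t\in(\mathbb F_q^* )^s\}\subseteq T_X(\mathbb F_q)$, where $\mathbf t^{\mathbf q}=t_1^{q_1}\cdots t_s^{q_s}$. *)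

theory Defs
  imports
    "Jordan_Normal_Form.Matrix"
    "Jordan_Normal_Form.Matrix_Kernel"
    "HOL-Library.Poly_Mapping"
    "HOL-Algebra.Algebraic_Closure_Type"
    "HOL-Algebra.Generated_Groups"
    "HOL-Algebra.Ideal"
begin

text \<open>
  Indices are shifted: coordinates, rays and matrix entries are numbered from \<open>0\<close>.
  Throughout, \<open>\<Phi>\<close> is the \<open>r \<times> n\<close> integer matrix whose rows are the primitive ray generators, so
  \<open>r = dim_row \<Phi>\<close> and \<open>n = dim_col \<Phi>\<close>.
\<close>

section \<open>Fans\<close>

text \<open>The cone generated by the columns of \<open>M\<close>; without columns it is the zero cone.\<close>

definition col_cone :: "real mat \<Rightarrow> real vec set" where
  "col_cone M = {M *\<^sub>v c | c. c \<in> carrier_vec (dim_col M) \<and> (\<forall>i < dim_col M. 0 \<le> c $ i)}"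

definition rational_polyhedral_cone :: "nat \<Rightarrow> real vec set \<Rightarrow> bool" where
  "rational_polyhedral_cone n \<sigma> \<longleftrightarrow>
     (\<exists>k. \<exists>N \<in> carrier_mat n k. \<sigma> = col_cone (map_mat real_of_int N))"

definition strongly_convex_cone :: "nat \<Rightarrow> real vec set \<Rightarrow> bool" where
  "strongly_convex_cone n \<sigma> \<longleftrightarrow> \<sigma> \<inter> uminus ` \<sigma> = {0\<^sub>v n}"

definition simplicial_cone :: "nat \<Rightarrow> real vec set \<Rightarrow> bool" where
  "simplicial_cone n \<sigma> \<longleftrightarrow>
     (\<exists>k. \<exists>M \<in> carrier_mat n k. mat_kernel M = {0\<^sub>v k} \<and> \<sigma> = col_cone M)"

definition cone_face :: "nat \<Rightarrow> real vec set \<Rightarrow> real vec set \<Rightarrow> bool" where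
  "cone_face n \<tau> \<sigma> \<longleftrightarrow>
     (\<exists>u \<in> carrier_vec n. (\<forall>x \<in> \<sigma>. 0 \<le> u \<bullet> x) \<and> \<tau> = {x \<in> \<sigma>. u \<bullet> x = 0})"

definition fan :: "nat \<Rightarrow> real vec set set \<Rightarrow> bool" where
  "fan n \<Sigma> \<longleftrightarrow>
     finite \<Sigma> \<and>
     (\<forall>\<sigma> \<in> \<Sigma>. rational_polyhedral_cone n \<sigma> \<and> strongly_convex_cone n \<sigma>) \<and>
     (\<forall>\<sigma> \<in> \<Sigma>. \<forall>\<tau>. cone_face n \<tau> \<sigma> \<longrightarrow> \<tau> \<in> \<Sigma>) \<and>
     (\<forall>\<sigma> \<in> \<Sigma>. \<forall>\<tau> \<in> \<Sigma>. cone_face n (\<sigma> \<inter> \<tau>) \<sigma> \<and> cone_face n (\<sigma> \<inter> \<tau>) \<tau>)"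

definition complete_simplicial_fan :: "nat \<Rightarrow> real vec set set \<Rightarrow> bool" where
  "complete_simplicial_fan n \<Sigma> \<longleftrightarrow>
     fan n \<Sigma> \<and> \<Union>\<Sigma> = carrier_vec n \<and> (\<forall>\<sigma> \<in> \<Sigma>. simplicial_cone n \<sigma>)"

text \<open>A one-dimensional strongly convex cone is a half-line.\<close>

definition fan_rays :: "nat \<Rightarrow> real vec set set \<Rightarrow> real vec set set" where
  "fan_rays n \<Sigma> =
     {\<rho> \<in> \<Sigma>. \<exists>v \<in> carrier_vec n. v \<noteq> 0\<^sub>v n \<and> \<rho> = {c \<cdot>\<^sub>v v | c. 0 \<le> c}}"

definition row_ray :: "int mat \<Rightarrow> nat \<Rightarrow> real vec set" where
  "row_ray \<Phi> i = {c \<cdot>\<^sub>v map_vec real_of_int (row \<Phi> i) | c. 0 \<le> c}"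

definition primitive_ray_generators :: "int mat \<Rightarrow> real vec set set \<Rightarrow> bool" where
  "primitive_ray_generators \<Phi> \<Sigma> \<longleftrightarrow>
     (\<forall>i < dim_row \<Phi>. Gcd (set\<^sub>v (row \<Phi> i)) = 1) \<and>
     bij_betw (row_ray \<Phi>) {..<dim_row \<Phi>} (fan_rays (dim_col \<Phi>) \<Sigma>)"

section \<open>Lattices\<close>

definition int_image :: "int mat \<Rightarrow> int vec set" where
  "int_image M = {M *\<^sub>v u | u. u \<in> carrier_vec (dim_col M)}"

definition short_exact :: "int mat \<Rightarrow> int mat \<Rightarrow> bool" where
  "short_exact \<Phi> \<beta> \<longleftrightarrow>
     mat_kernel \<Phi> = {0\<^sub>v (dim_col \<Phi>)} \<and>
     int_image \<Phi> = mat_kernel \<beta> \<and>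
     int_image \<beta> = carrier_vec (dim_row \<beta>)"

text \<open>The columns of \<open>M\<close> form a \<open>\<int>\<close>-basis of \<open>L\<close>; in particular \<open>L\<close> is a subgroup of
  \<open>\<int>\<^sup>r\<close> of rank \<open>dim_col M\<close>.\<close>

definition lattice_basis :: "int mat \<Rightarrow> int vec set \<Rightarrow> bool" where
  "lattice_basis M L \<longleftrightarrow> mat_kernel M = {0\<^sub>v (dim_col M)} \<and> L = int_image M"

section \<open>The Cox ring and its ideals\<close>

text \<open>A monomial is a finitely supported exponent function. The type has infinitely many
  variables; \<open>cox_ring r\<close> cuts out the polynomials in the first \<open>r\<close> of them.\<close>

type_synonym 'k cox_poly = "(nat \<Rightarrow>\<^sub>0 nat) \<Rightarrow>\<^sub>0 'k"

definition cox_ring :: "nat \<Rightarrow> 'k::field cox_poly ring" where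
  "cox_ring r =
     \<lparr>carrier = {F. \<forall>m \<in> Poly_Mapping.keys F. Poly_Mapping.keys m \<subseteq> {..<r}},
      monoid.mult = (*), one = 1, zero = 0, add = (+)\<rparr>"

definition poly_eval :: "'k::field cox_poly \<Rightarrow> 'k vec \<Rightarrow> 'k" where
  "poly_eval F P =
     (\<Sum>m \<in> Poly_Mapping.keys F.
        Poly_Mapping.lookup F m * (\<Prod>j < dim_vec P. P $ j ^ Poly_Mapping.lookup m j))"

definition homogeneous :: "int mat \<Rightarrow> 'k::field cox_poly \<Rightarrow> bool" where
  "homogeneous \<beta> F \<longleftrightarrow>
     (\<exists>\<delta>. \<forall>m \<in> Poly_Mapping.keys F.
        \<beta> *\<^sub>v vec (dim_col \<beta>) (\<lambda>j. int (Poly_Mapping.lookup m j)) = \<delta>)"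

text \<open>Since \<open>nat\<close> truncates negative numbers, \<open>pos_part m\<close> is \<open>m\<^sup>+\<close> and
  \<open>pos_part (- m)\<close> is \<open>m\<^sup>-\<close>.\<close>

definition pos_part :: "int vec \<Rightarrow> (nat \<Rightarrow>\<^sub>0 nat)" where
  "pos_part m = (\<Sum>j < dim_vec m. Poly_Mapping.single j (nat (m $ j)))"

definition lattice_ideal :: "nat \<Rightarrow> int vec set \<Rightarrow> 'k::field cox_poly set" where
  "lattice_ideal r L =
     genideal (cox_ring r)
       ((\<lambda>m. Poly_Mapping.single (pos_part m) 1 - Poly_Mapping.single (pos_part (- m)) 1) ` L)"

definition irrelevant_ideal :: "int mat \<Rightarrow> real vec set set \<Rightarrow> 'k::field cox_poly set" where
  "irrelevant_ideal \<Phi> \<Sigma> =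
     genideal (cox_ring (dim_row \<Phi>))
       ((\<lambda>\<sigma>. \<Prod>i \<in> {i. i < dim_row \<Phi> \<and> \<not> row_ray \<Phi> i \<subseteq> \<sigma>}.
           Poly_Mapping.single (Poly_Mapping.single i 1) 1) ` \<Sigma>)"

section \<open>Rational points of the toric variety\<close>

definition laurent_monomial :: "int vec \<Rightarrow> 'f::field vec \<Rightarrow> 'f" where
  "laurent_monomial a P = (\<Prod>j < dim_vec a. P $ j powi a $ j)"

definition torus_points :: "nat \<Rightarrow> 'f::field vec set" where
  "torus_points r = {P \<in> carrier_vec r. \<forall>j < r. P $ j \<noteq> 0}"

definition coord_mult :: "'f::field vec \<Rightarrow> 'f vec \<Rightarrow> 'f vec" where
  "coord_mult P Q = vec (dim_vec P) (\<lambda>j. P $ j * Q $ j)"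

definition cox_group :: "int mat \<Rightarrow> 'k::field alg_closure vec set" where
  "cox_group \<Phi> =
     {P \<in> torus_points (dim_row \<Phi>). \<forall>m \<in> int_image \<Phi>. laurent_monomial m P = 1}"

definition cox_orbit :: "int mat \<Rightarrow> 'k::field vec \<Rightarrow> 'k alg_closure vec set" where
  "cox_orbit \<Phi> P = (\<lambda>g. coord_mult g (map_vec to_ac P)) ` cox_group \<Phi>"

definition semistable_points :: "int mat \<Rightarrow> real vec set set \<Rightarrow> 'k::field vec set" where
  "semistable_points \<Phi> \<Sigma> =
     carrier_vec (dim_row \<Phi>) -
     {P. \<forall>F \<in> irrelevant_ideal \<Phi> \<Sigma>. poly_eval F P = 0}"

text \<open>Vanishing of a homogeneous polynomial does not depend on the representative of an orbit.\<close>

definition variety_zeros ::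
  "int mat \<Rightarrow> real vec set set \<Rightarrow> int mat \<Rightarrow> 'k::field cox_poly set
     \<Rightarrow> 'k alg_closure vec set set" where
  "variety_zeros \<Phi> \<Sigma> \<beta> J =
     {cox_orbit \<Phi> P | P. P \<in> semistable_points \<Phi> \<Sigma> \<and>
        (\<forall>F \<in> J. homogeneous \<beta> F \<longrightarrow> poly_eval F P = 0)}"

text \<open>The elementwise product of two orbits is the orbit of the product of representatives, and
  \<open>cox_group \<Phi>\<close> is the orbit of \<open>(1,\<dots>,1)\<close>. The second argument only selects the base field.\<close>

definition variety_torus :: "int mat \<Rightarrow> 'k::field itself \<Rightarrow> 'k alg_closure vec set monoid" where
  "variety_torus \<Phi> _ =
     \<lparr>carrier = cox_orbit \<Phi> ` (torus_points (dim_row \<Phi>) :: 'k vec set),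
      monoid.mult = (\<lambda>U W. {coord_mult x y | x y. x \<in> U \<and> y \<in> W}),
      one = cox_group \<Phi>\<rparr>"

definition parametrized_set :: "int mat \<Rightarrow> int mat \<Rightarrow> 'k::field alg_closure vec set set" where
  "parametrized_set \<Phi> Q =
     {cox_orbit \<Phi> (vec (dim_col Q) (\<lambda>j. laurent_monomial (col Q j) t)) | t :: 'k vec.
        t \<in> torus_points (dim_row Q)}"

section \<open>Roots of unity and direct products\<close>

definition generates_roots_of_unity :: "nat \<Rightarrow> 'k::field \<Rightarrow> bool" where
  "generates_roots_of_unity d \<eta> \<longleftrightarrow> {z. z ^ d = 1} = range (\<lambda>k::int. \<eta> powi k)"

definition internal_direct_product ::
  "('a, 'b) monoid_scheme \<Rightarrow> 'a set \<Rightarrow> 'i set \<Rightarrow> ('i \<Rightarrow> 'a set) \<Rightarrow> bool" where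
  "internal_direct_product T H I S \<longleftrightarrow>
     group T \<and> subgroup H T \<and>
     (\<forall>i \<in> I. normal (S i) (T\<lparr>carrier := H\<rparr>)) \<and>
     H = generate T (\<Union>i \<in> I. S i) \<and>
     (\<forall>i \<in> I. S i \<inter> generate T (\<Union>j \<in> I - {i}. S j) = {\<one>\<^bsub>T\<^esub>})"

end

theory Submission
  imports Defs
begin

text \<open>
  The idea is that the torus \<open>T\<^sub>X\<close> has coordinates in which the zero set of a lattice ideal is a
  product of groups of roots of unity. An orbit \<open>[P]\<close> with nonzero coordinates is determined by
  the values \<open>\<^bold>x\<^sup>m(P)\<close> for \<open>m\<close> in \<open>L\<^sub>\<beta>\<close>, so a basis \<open>w\<^sub>1, \<dots>, w\<^sub>n\<close> of \<open>L\<^sub>\<beta>\<close> gives an injection of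
  \<open>T\<^sub>X\<close> into \<open>(K\<^sup>*)\<^sup>n\<close>.

  The Smith normal form supplies the right basis: let \<open>W\<close> consist of the first \<open>n\<close> columns of
  \<open>A\<^sup>-\<^sup>1\<close>. From \<open>B C = A\<^sup>-\<^sup>1 D\<close> one reads off that \<open>d\<^sub>i w\<^sub>i\<close> is a basis of \<open>L\<close>, and the columns of \<open>W\<close>
  are a basis of \<open>L\<^sub>\<beta>\<close> because \<open>L\<close> has finite index in \<open>L\<^sub>\<beta>\<close> and \<open>L\<^sub>\<beta>\<close>, being a kernel, is saturated
  (\<open>smith_dual_basis\<close>). Moreover row \<open>i\<close> of \<open>A\<close> pairs with \<open>w\<^sub>k\<close> to \<open>\<delta>\<^sub>i\<^sub>k\<close>, so the point
  \<open>(\<Prod>\<^sub>i \<zeta>\<^sub>i\<^bsup>a\<^sub>i\<^sub>j\<^esup>)\<^sub>j\<close> has coordinates exactly \<open>\<zeta>\<close>. Hence \<open>T\<^sub>X\<close> is isomorphic to \<open>(K\<^sup>*)\<^sup>n\<close>, the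
  orbit \<open>[P\<^sub>i]\<close> is the element \<open>\<eta>\<^sub>i\<close> on the \<open>i\<close>-th axis, and the conditions \<open>\<^bold>x\<^sup>m(P) = 1\<close> for \<open>m\<close> in \<open>L\<close>
  become \<open>\<zeta>\<^sub>i\<close> to the power \<open>d\<^sub>i\<close> equal to \<open>1\<close>. Part (i) is then the decomposition of a product of
  cyclic groups along its axes (\<open>internal_direct_product_box\<close>). Part (ii) holds because over a
  field with \<open>q\<close> elements the \<open>d\<close>-th roots of unity, for \<open>d\<close> dividing \<open>q - 1\<close>, are precisely the
  \<open>(q - 1)/d\<close>-th powers of nonzero elements (\<open>box_eq_parametrized_set\<close>).

  What remains is that every zero of the lattice ideal on \<open>X\<close> lies in the torus
  (\<open>lattice_zero_in_torus\<close>). The vanishing coordinates of a point outside \<open>V(B)\<close> belong to rays of a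
  single cone. This cone is simplicial, so some integral functional is positive on all of these
  rays. A multiple of it is an element \<open>m\<close> of \<open>L\<close> that is positive at every vanishing coordinate; then
  \<open>\<^bold>x\<close> to the \<open>m\<^sup>+\<close> vanishes at the point while \<open>\<^bold>x\<close> to the \<open>m\<^sup>-\<close> does not.
\<close>

section \<open>Evaluation of Cox polynomials\<close>

definition monomial_eval :: "(nat \<Rightarrow>\<^sub>0 nat) \<Rightarrow> 'k::field vec \<Rightarrow> 'k" where
  "monomial_eval m P = (\<Prod>j < dim_vec P. P $ j ^ Poly_Mapping.lookup m j)"

lemma monomial_eval_0 [simp]: "monomial_eval 0 P = 1"
  by (simp add: monomial_eval_def)

lemma monomial_eval_add: "monomial_eval (m + m') P = monomial_eval m P * monomial_eval m' P"
  by (simp add: monomial_eval_def lookup_add power_add prod.distrib)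

text \<open>
  Enlarging the index set of the sum is what makes evaluation additive without any case
  distinction on cancelling monomials.
\<close>

lemma poly_eval_superset:
  assumes "finite S" "Poly_Mapping.keys F \<subseteq> S"
  shows "poly_eval F P = (\<Sum>m \<in> S. Poly_Mapping.lookup F m * monomial_eval m P)"
  unfolding poly_eval_def monomial_eval_def
  using assms by (intro sum.mono_neutral_left) (auto simp: in_keys_iff)

lemma poly_eval_0 [simp]: "poly_eval 0 P = 0"
  by (simp add: poly_eval_def)

lemma poly_eval_single [simp]: "poly_eval (Poly_Mapping.single m c) P = c * monomial_eval m P"
  by (subst poly_eval_superset[of "{m}"]) auto

lemma poly_eval_1 [simp]: "poly_eval 1 P = 1"
  using poly_eval_single[of 0 1 P] by (simp del: poly_eval_single)

lemma poly_eval_add: "poly_eval (F + G) P = poly_eval F P + poly_eval G P"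
proof -
  let ?S = "Poly_Mapping.keys F \<union> Poly_Mapping.keys G"
  have "Poly_Mapping.keys (F + G) \<subseteq> ?S" by (rule keys_add)
  then show ?thesis
    by (simp add: poly_eval_superset[of ?S] lookup_add distrib_right sum.distrib)
qed

lemma poly_eval_uminus: "poly_eval (- F) P = - poly_eval F P"
  using poly_eval_add[of F "- F" P] by (simp add: eq_neg_iff_add_eq_0 add.commute)

lemma poly_eval_diff: "poly_eval (F - G) P = poly_eval F P - poly_eval G P"
  using poly_eval_add[of F "- G" P] by (simp add: poly_eval_uminus)

text \<open>
  A polynomial is built by adding one term at a time, so an identity that is bilinear in its
  arguments needs to be checked on terms only.
\<close>

lemma poly_mapping_add_single_induct [case_names zero add]:
  assumes "Q 0" and "\<And>F m c. Q F \<Longrightarrow> Q (Poly_Mapping.single m c + F)"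
  shows "Q (F :: 'a \<Rightarrow>\<^sub>0 'b::comm_monoid_add)"
proof (induction F rule: update_induct)
  case (update F m c)
  have "Poly_Mapping.update m c F = Poly_Mapping.single m c + F"
    using update(1)
    by (intro poly_mapping_eqI) (auto simp: lookup_update lookup_add lookup_single in_keys_iff when_def)
  then show ?case using assms(2) update by metis
qed (fact assms(1))

lemma poly_eval_mult: "poly_eval (F * G) P = poly_eval F P * poly_eval G P"
proof (induction F rule: poly_mapping_add_single_induct)
  case (add F m c)
  have "poly_eval (Poly_Mapping.single m c * G) P = c * monomial_eval m P * poly_eval G P"
    by (induction G rule: poly_mapping_add_single_induct)
      (simp_all add: distrib_left mult_single poly_eval_add monomial_eval_add)
  with add show ?case by (simp add: distrib_right poly_eval_add)
qed simp

lemma poly_eval_prod: "poly_eval (\<Prod>i \<in> I. F i) P = (\<Prod>i \<in> I. poly_eval (F i) P)"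
  by (induction I rule: infinite_finite_induct) (simp_all add: poly_eval_mult)

lemma monomial_eval_single:
  assumes "i < dim_vec P"
  shows "monomial_eval (Poly_Mapping.single i k) P = P $ i ^ k"
proof -
  have "monomial_eval (Poly_Mapping.single i k) P = (\<Prod>j < dim_vec P. if j = i then P $ i ^ k else 1)"
    unfolding monomial_eval_def by (rule prod.cong) (auto simp: lookup_single when_def)
  then show ?thesis using assms by simp
qed

lemma ring_cox_ring: "ring (cox_ring r :: 'k::field cox_poly ring)"
proof (rule ringI)
  show "abelian_group (cox_ring r :: 'k cox_poly ring)"
  proof (rule abelian_groupI)
    fix x y :: "'k cox_poly"
    assume "x \<in> carrier (cox_ring r)" "y \<in> carrier (cox_ring r)"
    then show "x \<oplus>\<^bsub>cox_ring r\<^esub> y \<in> carrier (cox_ring r)"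
      using keys_add[of x y] by (fastforce simp: cox_ring_def)
  next
    fix x :: "'k cox_poly" assume "x \<in> carrier (cox_ring r)"
    then show "\<exists>y\<in>carrier (cox_ring r). y \<oplus>\<^bsub>cox_ring r\<^esub> x = \<zero>\<^bsub>cox_ring r\<^esub>"
      by (intro bexI[of _ "- x"]) (auto simp: cox_ring_def)
  qed (auto simp: cox_ring_def algebra_simps)
  show "Group.monoid (cox_ring r :: 'k cox_poly ring)"
  proof (rule monoidI)
    fix x y :: "'k cox_poly"
    assume xy: "x \<in> carrier (cox_ring r)" "y \<in> carrier (cox_ring r)"
    have "Poly_Mapping.keys m \<subseteq> {..<r}" if m: "m \<in> Poly_Mapping.keys (x * y)" for m
    proof -
      obtain a b where "m = a + b" "a \<in> Poly_Mapping.keys x" "b \<in> Poly_Mapping.keys y"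
        using keys_mult[of x y] m by blast
      then show ?thesis using xy keys_add[of a b] unfolding cox_ring_def by fastforce
    qed
    then show "x \<otimes>\<^bsub>cox_ring r\<^esub> y \<in> carrier (cox_ring r)"
      by (auto simp: cox_ring_def)
  qed (auto simp: cox_ring_def algebra_simps)
qed (auto simp: cox_ring_def algebra_simps)

text \<open>
  Evaluation at a point is a ring homomorphism; this is its kernel. Membership in a generated
  ideal enters the argument only through this ideal.
\<close>

lemma ideal_vanishing_at_point:
  "ideal {F \<in> carrier (cox_ring r). poly_eval F P = 0} (cox_ring r :: 'k::field cox_poly ring)"
    (is "ideal ?I ?R")
proof -
  interpret R: ring ?R by (rule ring_cox_ring)
  show ?thesis
  proof (rule idealI)
    show "ring ?R" by (rule ring_cox_ring)
    have inv: "\<ominus>\<^bsub>?R\<^esub> F = - F" if "F \<in> carrier ?R" for F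
      by (rule R.minus_equality) (use that in \<open>auto simp: cox_ring_def\<close>)
    have add: "x \<oplus>\<^bsub>?R\<^esub> y = x + y" "x \<otimes>\<^bsub>?R\<^esub> y = x * y" for x y
      by (simp_all add: cox_ring_def)
    show "subgroup ?I (add_monoid ?R)"
    proof (rule R.add.subgroupI)
      show "?I \<noteq> {}" using R.zero_closed by (auto simp: cox_ring_def intro: exI[of _ 0])
    next
      fix a assume "a \<in> ?I"
      then show "\<ominus>\<^bsub>?R\<^esub> a \<in> ?I" using R.a_inv_closed[of a] inv[of a]
        by (auto simp: poly_eval_uminus)
    next
      fix a b assume "a \<in> ?I" "b \<in> ?I"
      then show "a \<oplus>\<^bsub>?R\<^esub> b \<in> ?I" using R.a_closed[of a b]
        by (auto simp: poly_eval_add add)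
    qed auto
    show "x \<otimes>\<^bsub>?R\<^esub> a \<in> ?I" "a \<otimes>\<^bsub>?R\<^esub> x \<in> ?I" if "a \<in> ?I" "x \<in> carrier ?R" for a x
      using that R.m_closed[of a x] R.m_closed[of x a] by (auto simp: poly_eval_mult add)
  qed
qed

lemma poly_eval_genideal_eq_0:
  assumes "F \<in> genideal (cox_ring r) S" "S \<subseteq> carrier (cox_ring r)"
    and "\<And>G. G \<in> S \<Longrightarrow> poly_eval G P = 0"
  shows "poly_eval F P = 0"
proof -
  have "genideal (cox_ring r) S \<subseteq> {F \<in> carrier (cox_ring r). poly_eval F P = 0}"
    by (rule ring.genideal_minimal[OF ring_cox_ring ideal_vanishing_at_point]) (use assms in auto)
  then show ?thesis using assms(1) by auto
qed

lemma lookup_pos_part: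
  "Poly_Mapping.lookup (pos_part m) j = (if j < dim_vec m then nat (m $ j) else 0)"
  by (auto simp: pos_part_def lookup_sum lookup_single when_def)

lemma keys_pos_part: "Poly_Mapping.keys (pos_part m) \<subseteq> {..<dim_vec m}"
  by (auto simp: in_keys_iff lookup_pos_part split: if_splits)

text \<open>
  Clearing denominators: on the torus the binomial of \<open>m\<close> vanishes exactly where the character
  \<open>m\<close> is trivial.
\<close>

lemma laurent_monomial_eq_1_iff:
  assumes P: "P \<in> torus_points r" and m: "m \<in> carrier_vec r"
  shows "laurent_monomial m P = 1 \<longleftrightarrow>
         monomial_eval (pos_part m) P = monomial_eval (pos_part (- m)) P"
proof -
  have dims: "dim_vec P = r" "dim_vec m = r" and nz: "\<And>j. j < r \<Longrightarrow> P $ j \<noteq> 0"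
    using P m by (auto simp: torus_points_def)
  have "laurent_monomial m P * monomial_eval (pos_part (- m)) P = monomial_eval (pos_part m) P"
  proof -
    have "(\<Prod>j<r. P $ j powi m $ j * P $ j ^ nat (- m $ j)) = (\<Prod>j<r. P $ j ^ nat (m $ j))"
    proof (rule prod.cong)
      fix j assume "j \<in> {..<r}"
      then have "P $ j \<noteq> 0" using nz by simp
      have "P $ j powi m $ j * P $ j powi int (nat (- m $ j)) = P $ j powi (m $ j + int (nat (- m $ j)))"
        using \<open>P $ j \<noteq> 0\<close> by (simp only: power_int_add simp_thms)
      also have "m $ j + int (nat (- m $ j)) = int (nat (m $ j))" by simp
      finally show "P $ j powi m $ j * P $ j ^ nat (- m $ j) = P $ j ^ nat (m $ j)"
        by (simp only: power_int_of_nat)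
    qed simp
    then show ?thesis
      by (simp add: laurent_monomial_def monomial_eval_def lookup_pos_part dims prod.distrib)
  qed
  moreover have "monomial_eval (pos_part (- m)) P \<noteq> 0"
    using nz by (simp add: monomial_eval_def dims)
  ultimately show ?thesis by (metis mult_1 mult_cancel_right)
qed

section \<open>A basis adapted to the sublattice\<close>

lemma mult_mat_zero_vec:
  fixes M :: "'a::semiring_0 mat"
  assumes "M \<in> carrier_mat r n"
  shows "M *\<^sub>v 0\<^sub>v n = 0\<^sub>v r"
  using assms by (auto simp: scalar_prod_def intro!: eq_vecI)

lemma mult_mat_smult_vec:
  fixes M :: "'a::comm_semiring_0 mat"
  assumes "M \<in> carrier_mat r n" "v \<in> carrier_vec n"
  shows "M *\<^sub>v (k \<cdot>\<^sub>v v) = k \<cdot>\<^sub>v (M *\<^sub>v v)"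
  using assms by (auto simp: scalar_prod_def sum_distrib_left mult.left_commute intro!: eq_vecI)

lemma mem_int_image:
  assumes "M \<in> carrier_mat r n"
  shows "m \<in> int_image M \<longleftrightarrow> (\<exists>u \<in> carrier_vec n. m = M *\<^sub>v u)"
  using assms by (auto simp: int_image_def)

lemma int_image_mult_invertible:
  fixes C :: "int mat"
  assumes M: "M \<in> carrier_mat r n" and C: "C \<in> carrier_mat n n" "C' \<in> carrier_mat n n"
    and inv: "C * C' = 1\<^sub>m n"
  shows "int_image (M * C) = int_image M"
proof -
  have MC: "M * C \<in> carrier_mat r n" using M C by simp
  have "M *\<^sub>v (C *\<^sub>v u) = (M * C) *\<^sub>v u" if "u \<in> carrier_vec n" for u
    using M C(1) that by simp
  moreover have "M *\<^sub>v u = (M * C) *\<^sub>v (C' *\<^sub>v u)" if u: "u \<in> carrier_vec n" for u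
  proof -
    have "(M * C) *\<^sub>v (C' *\<^sub>v u) = M *\<^sub>v (C *\<^sub>v (C' *\<^sub>v u))"
      using M C u by (intro assoc_mult_mat_vec) auto
    also have "C *\<^sub>v (C' *\<^sub>v u) = (C * C') *\<^sub>v u" using C u by simp
    finally show ?thesis using inv u by simp
  qed
  ultimately show ?thesis
    using C by (auto simp: set_eq_iff mem_int_image[OF M] mem_int_image[OF MC])
      (metis mult_mat_vec_carrier)+
qed

lemma invertible_matE:
  fixes A :: "'a::semiring_1 mat"
  assumes "invertible_mat A" "A \<in> carrier_mat r r"
  obtains A' where "A' \<in> carrier_mat r r" "A * A' = 1\<^sub>m r" "A' * A = 1\<^sub>m r"
proof -
  obtain A' where *: "A * A' = 1\<^sub>m r" "A' * A = 1\<^sub>m (dim_row A')"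
    using assms by (auto simp: invertible_mat_def inverts_mat_def)
  have "dim_col A' = r" using arg_cong[OF *(1), of dim_col] by simp
  moreover have "dim_row A' = r" using arg_cong[OF *(2), of dim_col] assms(2) by simp
  ultimately show ?thesis using * that[of A'] by auto
qed

text \<open>
  Write \<open>B = M E\<close>. The square matrix \<open>E\<close> is injective because \<open>B\<close> is, and Cramer's rule
  \<open>E adj(E) = det(E)\<close> shows that \<open>\<bar>det E\<bar>\<close> clears the denominators of \<open>E\<^sup>-\<^sup>1\<close>.
\<close>

lemma multiple_in_full_rank_sublattice:
  fixes M B :: "int mat"
  assumes M: "M \<in> carrier_mat r n" and B: "B \<in> carrier_mat r n"
    and ker: "mat_kernel B = {0\<^sub>v n}" and sub: "int_image B \<subseteq> int_image M"
  obtains k :: int where "0 < k" "\<And>m. m \<in> int_image M \<Longrightarrow> k \<cdot>\<^sub>v m \<in> int_image B"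
proof -
  have "\<exists>u \<in> carrier_vec n. col B j = M *\<^sub>v u" if "j < n" for j
  proof -
    have "col B j = B *\<^sub>v unit_vec n j"
      using B that by (auto intro!: eq_vecI)
    then have "col B j \<in> int_image B" using mem_int_image[OF B] by auto
    then show ?thesis using sub mem_int_image[OF M] by blast
  qed
  then obtain u where u: "\<And>j. j < n \<Longrightarrow> u j \<in> carrier_vec n \<and> col B j = M *\<^sub>v u j"
    by metis
  define E where "E = mat n n (\<lambda>(i, j). u j $ i)"
  have E: "E \<in> carrier_mat n n" by (simp add: E_def)
  have colE: "col E j = u j" if "j < n" for j
    using u[OF that] that by (auto simp: E_def)
  have ME: "M * E = B"
  proof (rule mat_col_eqI)
    fix j assume "j < dim_col B"
    then show "col (M * E) j = col B j"
      using u[of j] colE[of j] B col_mult2[OF M E, of j] by simp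
  qed (use M B E in auto)
  have "det E \<noteq> 0"
  proof
    assume "det E = 0"
    then obtain v where v: "v \<in> carrier_vec n" "v \<noteq> 0\<^sub>v n" "E *\<^sub>v v = 0\<^sub>v n"
      using det_0_iff_vec_prod_zero[OF E] by auto
    have "B *\<^sub>v v = M *\<^sub>v (E *\<^sub>v v)"
      using ME M E v(1) by auto
    also have "\<dots> = 0\<^sub>v r" using mult_mat_zero_vec[OF M] by (simp add: v(3))
    finally have "v \<in> mat_kernel B" using B v by (auto simp: mat_kernel)
    then show False using ker v by simp
  qed
  show ?thesis
  proof
    show "0 < \<bar>det E\<bar>" using \<open>det E \<noteq> 0\<close> by simp
  next
    fix m assume "m \<in> int_image M"
    then obtain x where x: "x \<in> carrier_vec n" "m = M *\<^sub>v x"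
      using mem_int_image[OF M] by auto
    note adj = adj_mat[OF E]
    \<comment> \<open>The sign turns the multiple by \<open>det E\<close> into one by \<open>\<bar>det E\<bar>\<close>.\<close>
    let ?y = "sgn (det E) \<cdot>\<^sub>v (adj_mat E *\<^sub>v x)"
    have y: "?y \<in> carrier_vec n" using adj(1) x by auto
    have "B *\<^sub>v ?y = sgn (det E) \<cdot>\<^sub>v (M * E *\<^sub>v (adj_mat E *\<^sub>v x))"
      using adj(1) x unfolding ME by (intro mult_mat_smult_vec[OF B]) auto
    also have "M * E *\<^sub>v (adj_mat E *\<^sub>v x) = M *\<^sub>v (E *\<^sub>v (adj_mat E *\<^sub>v x))"
      using adj(1) x M E by (intro assoc_mult_mat_vec) auto
    also have "E *\<^sub>v (adj_mat E *\<^sub>v x) = (E * adj_mat E) *\<^sub>v x"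
      using adj(1) x E by simp
    also have "\<dots> = det E \<cdot>\<^sub>v x"
      using x by (auto simp: adj(2) intro!: eq_vecI)
    also have "sgn (det E) \<cdot>\<^sub>v (M *\<^sub>v (det E \<cdot>\<^sub>v x)) = \<bar>det E\<bar> \<cdot>\<^sub>v m"
      using mult_mat_smult_vec[OF M x(1), of "det E"] x(2) by (simp add: smult_smult_assoc abs_sgn mult.commute)
    finally show "\<bar>det E\<bar> \<cdot>\<^sub>v m \<in> int_image B"
      using y mem_int_image[OF B] by metis
  qed
qed

text \<open>
  The columns of \<open>W\<close> are the first \<open>n\<close> columns of \<open>A\<^sup>-\<^sup>1\<close>; since \<open>B C = A\<^sup>-\<^sup>1 D\<close>, their multiples by
  \<open>d\<^sub>j\<close> form a basis of \<open>L\<close>. Both inclusions between the images of \<open>\<Phi>\<close> and \<open>W\<close> go through \<open>L\<close>. If \<open>m\<close>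
  is in the image of \<open>\<Phi>\<close>, a positive multiple of \<open>A m\<close> is in the image of \<open>D\<close>, so the entries of
  \<open>A m\<close> beyond the first \<open>n\<close> vanish and \<open>m\<close> is in the image of \<open>W\<close>. Conversely a multiple of each
  \<open>W z\<close> is in \<open>L\<close>, hence in the kernel of \<open>\<beta>\<close>, and kernels are saturated.
\<close>

lemma smith_dual_basis:
  fixes \<Phi> \<beta> A B C :: "int mat"
  assumes Phi: "\<Phi> \<in> carrier_mat r n" and beta: "\<beta> \<in> carrier_mat s r"
    and saturated: "int_image \<Phi> = mat_kernel \<beta>"
    and sub: "L \<subseteq> int_image \<Phi>"
    and B: "B \<in> carrier_mat r n" and basis: "lattice_basis B L"
    and A: "A \<in> carrier_mat r r" "invertible_mat A"
    and C: "C \<in> carrier_mat n n" "invertible_mat C"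
    and smith: "A * B * C = mat r n (\<lambda>(i, j). if i = j then int (d j) else 0)"
    and d_pos: "\<And>i. i < n \<Longrightarrow> 0 < d i"
  obtains W where "n \<le> r" "W \<in> carrier_mat r n" "int_image \<Phi> = int_image W"
    "L = int_image (mat r n (\<lambda>(i, j). int (d j) * W $$ (i, j)))"
    "\<And>i k. i < n \<Longrightarrow> k < n \<Longrightarrow> row A i \<bullet> col W k = (if i = k then 1 else 0)"
proof -
  let ?D = "mat r n (\<lambda>(i, j). if i = j then int (d j) else 0)"
  have D: "?D \<in> carrier_mat r n" by simp
  obtain A' where A': "A' \<in> carrier_mat r r" "A * A' = 1\<^sub>m r" "A' * A = 1\<^sub>m r"
    using invertible_matE[OF A(2,1)] .
  obtain C' where C': "C' \<in> carrier_mat n n" "C * C' = 1\<^sub>m n" "C' * C = 1\<^sub>m n"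
    using invertible_matE[OF C(2,1)] .
  have kerB: "mat_kernel B = {0\<^sub>v n}" and L: "L = int_image B"
    using basis B by (auto simp: lattice_basis_def)
  have BC: "B * C = A' * ?D"
  proof -
    have "A' * ?D = A' * (A * (B * C))"
      using A B C smith by (simp flip: smith)
    also have "\<dots> = (A' * A) * (B * C)"
      using A A' B C by (intro assoc_mult_mat[symmetric]) auto
    finally show ?thesis using A' B C by simp
  qed
  have "n \<le> r"
  proof (rule ccontr)
    assume "\<not> n \<le> r"
    then have r: "r < n" by simp
    \<comment> \<open>Otherwise \<open>D\<close> has a zero column, which contradicts the injectivity of \<open>B C\<close>.\<close>
    let ?e = "unit_vec n r :: int vec"
    have "?D *\<^sub>v ?e = 0\<^sub>v r" using r by (auto intro!: eq_vecI)
    then have "B * C *\<^sub>v ?e = 0\<^sub>v r"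
      using mult_mat_zero_vec[OF A'(1)] by (simp add: BC assoc_mult_mat_vec[OF A'(1) D])
    then have "C *\<^sub>v ?e \<in> mat_kernel B"
      using B C by (auto simp: mat_kernel)
    then have "C *\<^sub>v ?e = 0\<^sub>v n" using kerB by simp
    then have "C' *\<^sub>v (C *\<^sub>v ?e) = 0\<^sub>v n"
      using mult_mat_zero_vec[OF C'(1)] by simp
    moreover have "C' *\<^sub>v (C *\<^sub>v ?e) = (C' * C) *\<^sub>v ?e"
      using C C' by (intro assoc_mult_mat_vec[symmetric]) auto
    ultimately have "?e = 0\<^sub>v n" using C'(3) by simp
    then have "?e $ r = 0" using r by simp
    then show False using r by simp
  qed
  define W where "W = mat r n (\<lambda>(i, j). A' $$ (i, j))"
  have W: "W \<in> carrier_mat r n" by (simp add: W_def)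
  have colW: "col W k = col A' k" if "k < n" for k
    using that A' \<open>n \<le> r\<close> by (auto simp: W_def intro!: eq_vecI)
  define W' where "W' = mat r n (\<lambda>(i, j). int (d j) * W $$ (i, j))"
  have W': "W' \<in> carrier_mat r n" by (simp add: W'_def)
  have A'D: "A' * ?D = W'"
  proof (rule eq_matI)
    fix i j assume ij: "i < dim_row W'" "j < dim_col W'"
    then have ij: "i < r" "j < n" "j < r" using \<open>n \<le> r\<close> by (auto simp: W'_def)
    have "(A' * ?D) $$ (i, j) = (\<Sum>k = 0..<r. A' $$ (i, k) * (if k = j then int (d j) else 0))"
      using ij A' by (simp add: scalar_prod_def)
    also have "\<dots> = (\<Sum>k = 0..<r. if k = j then A' $$ (i, j) * int (d j) else 0)"
      by (rule sum.cong) auto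
    also have "\<dots> = W' $$ (i, j)" using ij by (simp add: W'_def W_def)
    finally show "(A' * ?D) $$ (i, j) = W' $$ (i, j)" .
  qed (use A' W' in auto)
  have L': "L = int_image W'"
    using int_image_mult_invertible[OF B C(1) C'(1,2)] by (simp add: L BC A'D)
  have image: "int_image \<Phi> = int_image W"
  proof (intro equalityI subsetI)
    fix m assume "m \<in> int_image \<Phi>"
    then have m: "m \<in> carrier_vec r" using Phi by (auto simp: mem_int_image)
    obtain k where k: "0 < k" "k \<cdot>\<^sub>v m \<in> L"
      using multiple_in_full_rank_sublattice[OF Phi B kerB] sub L \<open>m \<in> int_image \<Phi>\<close> by metis
    then obtain z where z: "z \<in> carrier_vec n" "k \<cdot>\<^sub>v m = W' *\<^sub>v z"
      using L' mem_int_image[OF W'] by auto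
    have "A *\<^sub>v (k \<cdot>\<^sub>v m) = ?D *\<^sub>v z"
    proof -
      have "A *\<^sub>v (k \<cdot>\<^sub>v m) = (A * (A' * ?D)) *\<^sub>v z"
        using z A W' by (simp add: A'D)
      also have "A * (A' * ?D) = (A * A') * ?D"
        using A A' D by (intro assoc_mult_mat[symmetric]) auto
      finally show ?thesis using A' by simp
    qed
    then have Am: "k \<cdot>\<^sub>v (A *\<^sub>v m) = ?D *\<^sub>v z" using mult_mat_smult_vec[OF A(1) m, of k] by simp
    have zero: "(A *\<^sub>v m) $ i = 0" if "n \<le> i" "i < r" for i
    proof -
      have "(?D *\<^sub>v z) $ i = 0" using that z by (auto simp: scalar_prod_def)
      then have "(k \<cdot>\<^sub>v (A *\<^sub>v m)) $ i = 0" by (simp add: Am)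
      then show ?thesis using k A that by simp
    qed
    let ?z = "vec n (\<lambda>i. (A *\<^sub>v m) $ i)"
    have "m = (A' * A) *\<^sub>v m" using A' m by simp
    also have "\<dots> = A' *\<^sub>v (A *\<^sub>v m)" using A A' m by (intro assoc_mult_mat_vec) auto
    also have "\<dots> = W *\<^sub>v ?z"
    proof (rule eq_vecI)
      fix i assume "i < dim_vec (W *\<^sub>v ?z)"
      then have i: "i < r" using W by simp
      have "(A' *\<^sub>v (A *\<^sub>v m)) $ i = (\<Sum>j = 0..<r. A' $$ (i, j) * (A *\<^sub>v m) $ j)"
        using A A' i by (simp add: scalar_prod_def)
      also have "\<dots> = (\<Sum>j = 0..<n. A' $$ (i, j) * (A *\<^sub>v m) $ j)"
        by (rule sum.mono_neutral_right) (use \<open>n \<le> r\<close> zero in auto)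
      also have "\<dots> = (W *\<^sub>v ?z) $ i"
        using i by (simp add: W_def scalar_prod_def)
      finally show "(A' *\<^sub>v (A *\<^sub>v m)) $ i = (W *\<^sub>v ?z) $ i" .
    qed (use A' W in auto)
    finally show "m \<in> int_image W" using mem_int_image[OF W] by (metis vec_carrier)
  next
    fix m assume "m \<in> int_image W"
    then obtain z where z: "z \<in> carrier_vec n" "m = W *\<^sub>v z" using mem_int_image[OF W] by auto
    then have m: "m \<in> carrier_vec r" using W by simp
    \<comment> \<open>Any common multiple of the \<open>d\<^sub>i\<close> sends the image of \<open>W\<close> into \<open>L\<close>.\<close>
    define k where "k = (\<Prod>i<n. int (d i))"
    have "k \<noteq> 0" using d_pos by (simp add: k_def)
    have k: "int (d j) * (k div int (d j)) = k" if "j < n" for j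
      using that by (auto simp: k_def intro!: dvd_mult_div_cancel dvd_prodI)
    let ?z = "vec n (\<lambda>j. k div int (d j) * z $ j)"
    have "k \<cdot>\<^sub>v m = W' *\<^sub>v ?z"
    proof (rule eq_vecI)
      fix i assume "i < dim_vec (W' *\<^sub>v ?z)"
      then have i: "i < r" using W' by simp
      have "k * W $$ (i, j) * z $ j = W' $$ (i, j) * (k div int (d j) * z $ j)" if "j < n" for j
      proof -
        have "k * W $$ (i, j) * z $ j = (int (d j) * (k div int (d j))) * W $$ (i, j) * z $ j"
          by (simp only: k[OF that])
        then show ?thesis using that i by (simp add: W'_def ac_simps)
      qed
      then have "(\<Sum>j = 0..<n. k * W $$ (i, j) * z $ j) =
          (\<Sum>j = 0..<n. W' $$ (i, j) * (k div int (d j) * z $ j))"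
        by (intro sum.cong) auto
      then show "(k \<cdot>\<^sub>v m) $ i = (W' *\<^sub>v ?z) $ i"
        using i W W' z by (simp add: scalar_prod_def sum_distrib_left mult.assoc)
    qed (use W W' m in auto)
    then have "k \<cdot>\<^sub>v m \<in> L" using L' mem_int_image[OF W'] by (metis vec_carrier)
    then have "k \<cdot>\<^sub>v m \<in> mat_kernel \<beta>" using sub saturated by auto
    then have "k \<cdot>\<^sub>v (\<beta> *\<^sub>v m) = 0\<^sub>v s"
      using mult_mat_smult_vec[OF beta m, of k] beta by (auto simp: mat_kernel)
    then have "(\<beta> *\<^sub>v m) $ i = 0" if "i < s" for i
      using that \<open>k \<noteq> 0\<close> beta
      by (metis carrier_matD(1) dim_mult_mat_vec index_smult_vec(1) index_zero_vec(1) mult_eq_0_iff)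
    then have "\<beta> *\<^sub>v m = 0\<^sub>v s" using beta by (intro eq_vecI) auto
    then show "m \<in> int_image \<Phi>" using m beta saturated by (auto simp: mat_kernel)
  qed
  have "row A i \<bullet> col W k = (if i = k then 1 else 0)" if "i < n" "k < n" for i k
  proof -
    have "row A i \<bullet> col W k = (A * A') $$ (i, k)"
      using that \<open>n \<le> r\<close> A A'(1) by (simp add: colW)
    then show ?thesis using that \<open>n \<le> r\<close> by (simp add: A'(2))
  qed
  then show ?thesis using that[OF \<open>n \<le> r\<close> W image] L' by (auto simp: W'_def)
qed

section \<open>Characters and Laurent monomials\<close>

lemma power_int_sum:
  fixes x :: "'a::field"
  assumes "x \<noteq> 0"
  shows "x powi (\<Sum>i \<in> I. f i) = (\<Prod>i \<in> I. x powi f i)"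
  using assms by (induction I rule: infinite_finite_induct) (simp_all add: power_int_add)

lemma prod_power_int:
  fixes f :: "'i \<Rightarrow> 'a::field"
  shows "(\<Prod>i \<in> I. f i) powi k = (\<Prod>i \<in> I. f i powi k)"
  by (induction I rule: infinite_finite_induct) (simp_all add: power_int_mult_distrib)

lemma generates_roots_of_unity_power:
  assumes "generates_roots_of_unity d \<eta>"
  shows "\<eta> ^ d = 1"
proof -
  have "\<eta> powi 1 \<in> {z. z ^ d = 1}"
    using assms by (simp only: generates_roots_of_unity_def) (rule rangeI)
  then show ?thesis by simp
qed

lemma to_ac_power_int: "to_ac (x powi k) = to_ac x powi k"
  by (simp add: power_int_def)

lemma coord_mult_torus_points:
  "P \<in> torus_points r \<Longrightarrow> Q \<in> torus_points r \<Longrightarrow> coord_mult P Q \<in> torus_points r"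
  by (auto simp: torus_points_def coord_mult_def)

lemma map_to_ac_torus_points: "P \<in> torus_points r \<Longrightarrow> map_vec to_ac P \<in> torus_points r"
  by (auto simp: torus_points_def)

lemma laurent_monomial_coord_mult:
  assumes "P \<in> carrier_vec r" "Q \<in> carrier_vec r" "m \<in> carrier_vec r"
  shows "laurent_monomial m (coord_mult P Q) = laurent_monomial m P * laurent_monomial m Q"
  using assms
  by (simp add: laurent_monomial_def coord_mult_def power_int_mult_distrib prod.distrib)

lemma laurent_monomial_map_to_ac:
  assumes "P \<in> carrier_vec r" "m \<in> carrier_vec r"
  shows "laurent_monomial m (map_vec to_ac P) = to_ac (laurent_monomial m P)"
  using assms by (simp add: laurent_monomial_def to_ac_prod to_ac_power_int)

lemma laurent_monomial_nonzero:
  assumes "P \<in> torus_points r" "m \<in> carrier_vec r"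
  shows "laurent_monomial m P \<noteq> 0"
  using assms by (auto simp: laurent_monomial_def torus_points_def)

text \<open>
  A character is multiplicative in its exponent, so on the image of \<open>M\<close> it is determined by the
  columns of \<open>M\<close>.
\<close>

lemma laurent_monomial_mult_mat_vec:
  assumes P: "P \<in> torus_points r" and M: "M \<in> carrier_mat r n" and z: "z \<in> carrier_vec n"
  shows "laurent_monomial (M *\<^sub>v z) P = (\<Prod>j<n. laurent_monomial (col M j) P powi z $ j)"
proof -
  have nz: "P $ i \<noteq> 0" if "i < r" for i using P that by (simp add: torus_points_def)
  have "laurent_monomial (M *\<^sub>v z) P = (\<Prod>i<r. P $ i powi (\<Sum>j<n. M $$ (i, j) * z $ j))"
    using M z by (simp add: laurent_monomial_def scalar_prod_def atLeast0LessThan)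
  also have "\<dots> = (\<Prod>i<r. \<Prod>j<n. (P $ i powi M $$ (i, j)) powi z $ j)"
    using nz by (intro prod.cong) (simp_all add: power_int_sum power_int_mult)
  also have "\<dots> = (\<Prod>j<n. \<Prod>i<r. (P $ i powi M $$ (i, j)) powi z $ j)"
    by (rule prod.swap)
  also have "\<dots> = (\<Prod>j<n. laurent_monomial (col M j) P powi z $ j)"
    using M by (intro prod.cong) (simp_all add: laurent_monomial_def prod_power_int)
  finally show ?thesis .
qed

lemma laurent_monomial_eq_1_on_int_image:
  assumes P: "P \<in> torus_points r" and M: "M \<in> carrier_mat r n"
  shows "(\<forall>m \<in> int_image M. laurent_monomial m P = 1) \<longleftrightarrow> (\<forall>j<n. laurent_monomial (col M j) P = 1)"
proof
  assume *: "\<forall>m \<in> int_image M. laurent_monomial m P = 1"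
  show "\<forall>j<n. laurent_monomial (col M j) P = 1"
  proof (intro allI impI)
    fix j assume "j < n"
    then have "col M j = M *\<^sub>v unit_vec n j" using M by (auto intro!: eq_vecI)
    then have "col M j \<in> int_image M" unfolding mem_int_image[OF M] using unit_vec_carrier by (rule bexI)
    then show "laurent_monomial (col M j) P = 1" by (rule *[rule_format])
  qed
next
  assume *: "\<forall>j<n. laurent_monomial (col M j) P = 1"
  show "\<forall>m \<in> int_image M. laurent_monomial m P = 1"
  proof
    fix m assume "m \<in> int_image M"
    then obtain z where "z \<in> carrier_vec n" "m = M *\<^sub>v z" using mem_int_image[OF M] by auto
    then show "laurent_monomial m P = 1" using * laurent_monomial_mult_mat_vec[OF P M, of z] by simp
  qed
qed

section \<open>Coordinates on the torus\<close>

lemma internal_direct_product_cong: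
  assumes "internal_direct_product T H I S" "\<And>i. i \<in> I \<Longrightarrow> S i = S' i"
  shows "internal_direct_product T H I S'"
proof -
  have "(\<Union>j \<in> J. S' j) = (\<Union>j \<in> J. S j)" if "J \<subseteq> I" for J
    using assms(2) that by auto
  then have unions: "(\<Union>i \<in> I. S' i) = (\<Union>i \<in> I. S i)"
    "(\<Union>j \<in> I - {i}. S' j) = (\<Union>j \<in> I - {i}. S j)" for i
    by blast+
  show ?thesis
    using assms(1) unfolding internal_direct_product_def unions
    by (elim conjE, intro conjI ballI) (simp_all add: assms(2)[symmetric])
qed

text \<open>
  The point of the torus with prescribed coordinates \<open>\<zeta>\<close> with respect to a basis dual to the first
  \<open>n\<close> rows of \<open>A\<close>.
\<close>

definition dual_point :: "int mat \<Rightarrow> nat \<Rightarrow> (nat \<Rightarrow> 'k::field) \<Rightarrow> 'k vec" where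
  "dual_point A n \<zeta> = vec (dim_col A) (\<lambda>j. \<Prod>i<n. \<zeta> i powi A $$ (i, j))"

text \<open>
  A basis \<open>W\<close> of the lattice \<open>L\<^sub>\<beta>\<close> together with dual rows of \<open>A\<close>. The characters given by the columns
  of \<open>W\<close> are coordinates on the torus of the toric variety, and \<open>A\<close> provides the inverse map.
\<close>

locale torus_coordinates =
  fixes \<Phi> W A :: "int mat" and r n :: nat
  assumes Phi: "\<Phi> \<in> carrier_mat r n" and W: "W \<in> carrier_mat r n" and A: "A \<in> carrier_mat r r"
    and n_le: "n \<le> r"
    and image: "int_image \<Phi> = int_image W"
    and dual: "\<And>i k. i < n \<Longrightarrow> k < n \<Longrightarrow> row A i \<bullet> col W k = (if i = k then 1 else 0)"
begin

lemma col_W: "col W k \<in> carrier_vec r"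
  using W by auto

lemma cox_group_eq:
  "cox_group \<Phi> = {g \<in> torus_points r. \<forall>k<n. laurent_monomial (col W k) g = 1}"
  using Phi laurent_monomial_eq_1_on_int_image[OF _ W] by (auto simp: cox_group_def image)

text \<open>
  The group acting on representatives is the common kernel of the characters in \<open>L\<^sub>\<beta>\<close>, so these
  characters are well defined on orbits, although an orbit consists of points over the algebraic
  closure.
\<close>

lemma laurent_monomial_cox_orbit:
  assumes "x \<in> cox_orbit \<Phi> P" "P \<in> carrier_vec r" "k < n"
  shows "laurent_monomial (col W k) x = to_ac (laurent_monomial (col W k) P)"
proof -
  obtain g where g: "g \<in> cox_group \<Phi>" "x = coord_mult g (map_vec to_ac P)"
    using assms(1) by (auto simp: cox_orbit_def)
  then show ?thesis
    using assms(2,3) laurent_monomial_coord_mult[of g r "map_vec to_ac P" "col W k"] col_W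
      laurent_monomial_map_to_ac[OF assms(2), of "col W k"]
    by (auto simp: cox_group_eq torus_points_def)
qed

lemma cox_orbit_self:
  assumes "P \<in> carrier_vec r"
  shows "map_vec to_ac P \<in> cox_orbit \<Phi> P"
proof -
  have "vec r (\<lambda>_. 1) \<in> cox_group \<Phi>"
    using W by (auto simp: cox_group_eq torus_points_def laurent_monomial_def)
  moreover have "map_vec to_ac P = coord_mult (vec r (\<lambda>_. 1)) (map_vec to_ac P)"
    using assms by (auto simp: coord_mult_def)
  ultimately show ?thesis by (auto simp: cox_orbit_def)
qed

text \<open>
  The coordinates separate orbits: if they agree on \<open>P\<close> and \<open>Q\<close>, the quotient of any point of the
  orbit of \<open>P\<close> by \<open>Q\<close> lies in the acting group.
\<close>

lemma cox_orbit_eq_iff: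
  fixes P Q :: "'k::field vec"
  assumes P: "P \<in> torus_points r" and Q: "Q \<in> torus_points r"
  shows "cox_orbit \<Phi> P = cox_orbit \<Phi> Q \<longleftrightarrow>
         (\<forall>k<n. laurent_monomial (col W k) P = laurent_monomial (col W k) Q)"
proof
  have cP: "P \<in> carrier_vec r" "Q \<in> carrier_vec r" using P Q by (auto simp: torus_points_def)
  assume "cox_orbit \<Phi> P = cox_orbit \<Phi> Q"
  then have "to_ac (laurent_monomial (col W k) P) = to_ac (laurent_monomial (col W k) Q)" if "k < n" for k
    using laurent_monomial_cox_orbit that cP cox_orbit_self[OF cP(1)] by metis
  then show "\<forall>k<n. laurent_monomial (col W k) P = laurent_monomial (col W k) Q" by simp
next
  assume eq: "\<forall>k<n. laurent_monomial (col W k) P = laurent_monomial (col W k) Q"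
  have sub: "cox_orbit \<Phi> P \<subseteq> cox_orbit \<Phi> Q"
    if P: "P \<in> torus_points r" and Q: "Q \<in> torus_points r"
      and eq: "\<forall>k<n. laurent_monomial (col W k) P = laurent_monomial (col W k) Q" for P Q :: "'k vec"
  proof
    fix x assume x: "x \<in> cox_orbit \<Phi> P"
    have c: "P \<in> carrier_vec r" "Q \<in> carrier_vec r" using P Q by (auto simp: torus_points_def)
    have xt: "x \<in> torus_points r"
      using x coord_mult_torus_points[OF _ map_to_ac_torus_points[OF P]]
      by (auto simp: cox_orbit_def cox_group_eq)
    define h where "h = vec r (\<lambda>j. x $ j / to_ac (Q $ j))"
    have ht: "h \<in> torus_points r" using xt Q by (auto simp: h_def torus_points_def)
    have hx: "coord_mult h (map_vec to_ac Q) = x"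
      using xt Q by (auto simp: h_def coord_mult_def torus_points_def intro!: eq_vecI)
    have "laurent_monomial (col W k) h = 1" if "k < n" for k
    proof -
      have "laurent_monomial (col W k) h * to_ac (laurent_monomial (col W k) Q) =
            laurent_monomial (col W k) x"
        using laurent_monomial_coord_mult[of h r "map_vec to_ac Q" "col W k"] ht c col_W[of k]
          laurent_monomial_map_to_ac[OF c(2) col_W[of k]]
        by (simp add: hx torus_points_def)
      also have "\<dots> = to_ac (laurent_monomial (col W k) Q)"
        using laurent_monomial_cox_orbit[OF x c(1) that] eq that by simp
      finally show ?thesis using laurent_monomial_nonzero[OF Q col_W[of k]] by simp
    qed
    then have "h \<in> cox_group \<Phi>" using ht by (simp add: cox_group_eq)
    then show "x \<in> cox_orbit \<Phi> Q" using hx by (auto simp: cox_orbit_def)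
  qed
  show "cox_orbit \<Phi> P = cox_orbit \<Phi> Q"
    using sub[OF P Q eq] sub[OF Q P] eq by auto
qed

lemma cox_orbit_mult:
  fixes P Q :: "'k::field vec"
  assumes P: "P \<in> carrier_vec r" and Q: "Q \<in> carrier_vec r"
  shows "{coord_mult x y | x y. x \<in> cox_orbit \<Phi> P \<and> y \<in> cox_orbit \<Phi> Q} =
         cox_orbit \<Phi> (coord_mult P Q)"
proof (intro equalityI subsetI)
  fix z assume "z \<in> {coord_mult x y | x y. x \<in> cox_orbit \<Phi> P \<and> y \<in> cox_orbit \<Phi> Q}"
  then obtain g h where gh: "g \<in> cox_group \<Phi>" "h \<in> cox_group \<Phi>"
    "z = coord_mult (coord_mult g (map_vec to_ac P)) (coord_mult h (map_vec to_ac Q))"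
    by (auto simp: cox_orbit_def)
  then have "coord_mult g h \<in> cox_group \<Phi>"
    using laurent_monomial_coord_mult[of g r h] col_W
    by (auto simp: cox_group_eq coord_mult_torus_points) (simp add: torus_points_def)
  moreover have "z = coord_mult (coord_mult g h) (map_vec to_ac (coord_mult P Q))"
    using gh P Q by (auto simp: cox_group_eq coord_mult_def torus_points_def intro!: eq_vecI)
  ultimately show "z \<in> cox_orbit \<Phi> (coord_mult P Q)" by (auto simp: cox_orbit_def)
next
  fix z assume "z \<in> cox_orbit \<Phi> (coord_mult P Q)"
  then obtain g where g: "g \<in> cox_group \<Phi>" "z = coord_mult g (map_vec to_ac (coord_mult P Q))"
    by (auto simp: cox_orbit_def)
  have "z = coord_mult (coord_mult g (map_vec to_ac P)) (map_vec to_ac Q)"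
    using g P Q by (auto simp: cox_group_eq coord_mult_def torus_points_def intro!: eq_vecI)
  then show "z \<in> {coord_mult x y | x y. x \<in> cox_orbit \<Phi> P \<and> y \<in> cox_orbit \<Phi> Q}"
    using g(1) cox_orbit_self[OF Q] by (auto simp: cox_orbit_def)
qed

definition torus_class :: "(nat \<Rightarrow> 'k::field) \<Rightarrow> 'k alg_closure vec set" where
  "torus_class \<zeta> = cox_orbit \<Phi> (dual_point A n \<zeta>)"

lemma dual_point_torus:
  assumes "\<And>i. i < n \<Longrightarrow> \<zeta> i \<noteq> 0"
  shows "dual_point A n \<zeta> \<in> torus_points r"
  using assms A by (auto simp: dual_point_def torus_points_def)

text \<open>
  By duality the exponent of \<open>\<zeta>\<^sub>i\<close> in the \<open>k\<close>-th coordinate is \<open>\<delta>\<^sub>i\<^sub>k\<close>.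
\<close>

lemma laurent_monomial_dual_point:
  assumes nz: "\<And>i. i < n \<Longrightarrow> \<zeta> i \<noteq> 0" and k: "k < n"
  shows "laurent_monomial (col W k) (dual_point A n \<zeta>) = \<zeta> k"
proof -
  have "laurent_monomial (col W k) (dual_point A n \<zeta>) =
        (\<Prod>j<r. \<Prod>i<n. \<zeta> i powi (A $$ (i, j) * W $$ (j, k)))"
    using W A k
    by (simp add: laurent_monomial_def dual_point_def prod_power_int power_int_mult)
  also have "\<dots> = (\<Prod>i<n. \<Prod>j<r. \<zeta> i powi (A $$ (i, j) * W $$ (j, k)))"
    by (rule prod.swap)
  also have "\<dots> = (\<Prod>i<n. \<zeta> i powi (row A i \<bullet> col W k))"
    using nz A W k n_le
    by (intro prod.cong) (simp_all add: power_int_sum[symmetric] scalar_prod_def atLeast0LessThan)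
  also have "\<dots> = (\<Prod>i<n. if i = k then \<zeta> k else 1)"
    using k by (intro prod.cong) (auto simp: dual)
  finally show ?thesis using k by simp
qed

lemma cox_orbit_eq_torus_class:
  assumes "P \<in> torus_points r"
  shows "cox_orbit \<Phi> P = torus_class (\<lambda>k. laurent_monomial (col W k) P)"
  unfolding torus_class_def
  using laurent_monomial_nonzero[OF assms col_W]
  by (subst cox_orbit_eq_iff) (auto simp: assms dual_point_torus laurent_monomial_dual_point)

lemma torus_class_eq_iff:
  assumes "\<And>i. i < n \<Longrightarrow> \<zeta> i \<noteq> 0" "\<And>i. i < n \<Longrightarrow> \<xi> i \<noteq> 0"
  shows "torus_class \<zeta> = torus_class \<xi> \<longleftrightarrow> (\<forall>i<n. \<zeta> i = \<xi> i)"
  unfolding torus_class_def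
  using assms by (subst cox_orbit_eq_iff) (auto simp: dual_point_torus laurent_monomial_dual_point)

lemma torus_class_cong: "(\<And>i. i < n \<Longrightarrow> \<zeta> i = \<xi> i) \<Longrightarrow> torus_class \<zeta> = torus_class \<xi>"
  unfolding torus_class_def dual_point_def by simp

abbreviation torus :: "'k::field itself \<Rightarrow> 'k alg_closure vec set monoid" where
  "torus \<equiv> variety_torus \<Phi>"

lemma carrier_torus:
  "carrier (torus TYPE('k::field)) = {torus_class \<zeta> | \<zeta> :: nat \<Rightarrow> 'k. \<forall>i<n. \<zeta> i \<noteq> 0}"
proof (intro equalityI subsetI)
  fix U assume "U \<in> carrier (torus TYPE('k))"
  then obtain P :: "'k vec" where P: "P \<in> torus_points r" "U = cox_orbit \<Phi> P"
    using Phi by (auto simp: variety_torus_def)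
  have "\<forall>i<n. laurent_monomial (col W i) P \<noteq> 0"
    using laurent_monomial_nonzero[OF P(1) col_W] by simp
  then show "U \<in> {torus_class \<zeta> | \<zeta> :: nat \<Rightarrow> 'k. \<forall>i<n. \<zeta> i \<noteq> 0}"
    using cox_orbit_eq_torus_class[OF P(1)] P(2) by auto
next
  fix U assume "U \<in> {torus_class \<zeta> | \<zeta> :: nat \<Rightarrow> 'k. \<forall>i<n. \<zeta> i \<noteq> 0}"
  then show "U \<in> carrier (torus TYPE('k))"
    using Phi dual_point_torus by (auto simp: variety_torus_def torus_class_def)
qed

lemma one_torus: "\<one>\<^bsub>torus TYPE('k::field)\<^esub> = torus_class (\<lambda>_. 1 :: 'k)"
proof -
  have "torus_class (\<lambda>_. 1 :: 'k) = cox_orbit \<Phi> (vec r (\<lambda>_. 1 :: 'k))"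
    using A by (simp add: torus_class_def dual_point_def)
  also have "\<dots> = cox_group \<Phi>"
  proof -
    have "coord_mult g (map_vec to_ac (vec r (\<lambda>_. 1 :: 'k))) = g" if "g \<in> cox_group \<Phi>" for g
      using that by (auto simp: cox_group_eq torus_points_def coord_mult_def intro!: eq_vecI)
    then show ?thesis by (simp add: cox_orbit_def)
  qed
  finally show ?thesis by (simp add: variety_torus_def)
qed

lemma mult_torus:
  fixes \<zeta> \<xi> :: "nat \<Rightarrow> 'k::field"
  shows "torus_class \<zeta> \<otimes>\<^bsub>torus TYPE('k)\<^esub> torus_class \<xi> = torus_class (\<lambda>i. \<zeta> i * \<xi> i)"
proof -
  have "dual_point A n (\<lambda>i. \<zeta> i * \<xi> i) = coord_mult (dual_point A n \<zeta>) (dual_point A n \<xi>)"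
    by (auto simp: dual_point_def coord_mult_def power_int_mult_distrib prod.distrib intro!: eq_vecI)
  then show ?thesis
    using A by (simp add: torus_class_def variety_torus_def cox_orbit_mult dual_point_def)
qed

text \<open>
  In the coordinates \<open>\<zeta>\<close> the product of orbits is the product of nonzero field elements, and the group
  laws are inherited from there.
\<close>

lemma comm_group_torus: "comm_group (torus TYPE('k::field))"
proof (rule comm_groupI)
  fix U assume "U \<in> carrier (torus TYPE('k))"
  then obtain \<zeta> :: "nat \<Rightarrow> 'k" where \<zeta>: "U = torus_class \<zeta>" "\<forall>i<n. \<zeta> i \<noteq> 0"
    by (auto simp: carrier_torus)
  have "torus_class (\<lambda>i. inverse (\<zeta> i)) \<otimes>\<^bsub>torus TYPE('k)\<^esub> U = \<one>\<^bsub>torus TYPE('k)\<^esub>"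
    unfolding \<zeta>(1) mult_torus one_torus by (rule torus_class_cong) (use \<zeta>(2) in simp)
  moreover have "torus_class (\<lambda>i. inverse (\<zeta> i)) \<in> carrier (torus TYPE('k))"
    using \<zeta>(2) by (auto simp: carrier_torus)
  ultimately show "\<exists>V \<in> carrier (torus TYPE('k)). V \<otimes>\<^bsub>torus TYPE('k)\<^esub> U = \<one>\<^bsub>torus TYPE('k)\<^esub>"
    by blast
next
  fix U V assume "U \<in> carrier (torus TYPE('k))" "V \<in> carrier (torus TYPE('k))"
  then obtain \<zeta> \<xi> :: "nat \<Rightarrow> 'k" where UV: "U = torus_class \<zeta>" "V = torus_class \<xi>"
    and nz: "\<forall>i<n. \<zeta> i \<noteq> 0" "\<forall>i<n. \<xi> i \<noteq> 0"
    unfolding carrier_torus by blast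
  have "\<forall>i<n. \<zeta> i * \<xi> i \<noteq> 0" using nz by simp
  then show "U \<otimes>\<^bsub>torus TYPE('k)\<^esub> V \<in> carrier (torus TYPE('k))"
    unfolding UV mult_torus carrier_torus by blast
  show "U \<otimes>\<^bsub>torus TYPE('k)\<^esub> V = V \<otimes>\<^bsub>torus TYPE('k)\<^esub> U"
    unfolding UV mult_torus by (simp only: mult.commute)
next
  show "\<one>\<^bsub>torus TYPE('k)\<^esub> \<in> carrier (torus TYPE('k))"
    by (auto simp: carrier_torus one_torus)
next
  fix U V Y
  assume "U \<in> carrier (torus TYPE('k))" "V \<in> carrier (torus TYPE('k))" "Y \<in> carrier (torus TYPE('k))"
  then obtain \<zeta> \<xi> \<chi> :: "nat \<Rightarrow> 'k"
    where UVX: "U = torus_class \<zeta>" "V = torus_class \<xi>" "Y = torus_class \<chi>"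
    unfolding carrier_torus by blast
  show "U \<otimes>\<^bsub>torus TYPE('k)\<^esub> V \<otimes>\<^bsub>torus TYPE('k)\<^esub> Y =
        U \<otimes>\<^bsub>torus TYPE('k)\<^esub> (V \<otimes>\<^bsub>torus TYPE('k)\<^esub> Y)"
    unfolding UVX mult_torus by (simp only: mult.assoc)
next
  fix U assume "U \<in> carrier (torus TYPE('k))"
  then show "\<one>\<^bsub>torus TYPE('k)\<^esub> \<otimes>\<^bsub>torus TYPE('k)\<^esub> U = U"
    by (auto simp: carrier_torus one_torus mult_torus)
qed

lemma inv_torus:
  fixes \<zeta> :: "nat \<Rightarrow> 'k::field"
  assumes "\<And>i. i < n \<Longrightarrow> \<zeta> i \<noteq> 0"
  shows "inv\<^bsub>torus TYPE('k)\<^esub> (torus_class \<zeta>) = torus_class (\<lambda>i. inverse (\<zeta> i))"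
proof -
  interpret comm_group "torus TYPE('k)" by (rule comm_group_torus)
  have "torus_class (\<lambda>i. inverse (\<zeta> i)) \<otimes>\<^bsub>torus TYPE('k)\<^esub> torus_class \<zeta> = \<one>\<^bsub>torus TYPE('k)\<^esub>"
    unfolding mult_torus one_torus by (rule torus_class_cong) (use assms in simp)
  then show ?thesis
    using assms by (intro inv_equality) (auto simp: carrier_torus)
qed

text \<open>
  The product of subsets of \<open>K\<^sup>*\<close>, one for each coordinate. The zero set of the lattice ideal, and the
  subgroups that separate its cyclic factors, are all of this form.
\<close>

definition box :: "(nat \<Rightarrow> 'k::field \<Rightarrow> bool) \<Rightarrow> 'k alg_closure vec set set" where
  "box S = {torus_class \<zeta> | \<zeta>. \<forall>i<n. \<zeta> i \<noteq> 0 \<and> S i (\<zeta> i)}"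

lemma subgroup_box:
  fixes S :: "nat \<Rightarrow> 'k::field \<Rightarrow> bool"
  assumes one: "\<And>i. i < n \<Longrightarrow> S i 1"
    and mult: "\<And>i x y. i < n \<Longrightarrow> S i x \<Longrightarrow> S i y \<Longrightarrow> S i (x * y)"
    and inv: "\<And>i x. i < n \<Longrightarrow> S i x \<Longrightarrow> S i (inverse x)"
  shows "subgroup (box S) (torus TYPE('k))"
proof -
  interpret comm_group "torus TYPE('k)" by (rule comm_group_torus)
  show ?thesis
  proof (rule subgroupI)
    show "box S \<noteq> {}" using one by (auto simp: box_def intro: exI[of _ "\<lambda>_. 1"])
  next
    fix U assume "U \<in> box S"
    then obtain \<zeta> where \<zeta>: "U = torus_class \<zeta>" "\<forall>i<n. \<zeta> i \<noteq> 0 \<and> S i (\<zeta> i)"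
      by (auto simp: box_def)
    have "inv\<^bsub>torus TYPE('k)\<^esub> U = torus_class (\<lambda>i. inverse (\<zeta> i))"
      using \<zeta> by (simp add: inv_torus)
    then show "inv\<^bsub>torus TYPE('k)\<^esub> U \<in> box S" using \<zeta> inv by (auto simp: box_def)
  next
    fix U V assume "U \<in> box S" "V \<in> box S"
    then obtain \<zeta> \<xi> where "U = torus_class \<zeta>" "\<forall>i<n. \<zeta> i \<noteq> 0 \<and> S i (\<zeta> i)"
      "V = torus_class \<xi>" "\<forall>i<n. \<xi> i \<noteq> 0 \<and> S i (\<xi> i)"
      unfolding box_def by blast
    then show "U \<otimes>\<^bsub>torus TYPE('k)\<^esub> V \<in> box S"
      using mult by (auto simp: box_def mult_torus intro!: exI[of _ "\<lambda>i. \<zeta> i * \<xi> i"])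
  qed (auto simp: box_def carrier_torus)
qed

text \<open>
  The embedding of \<open>K\<^sup>*\<close> as the \<open>i\<close>-th coordinate axis. The orbits that generate the zero set of the
  lattice ideal lie on the axes.
\<close>

definition axis :: "nat \<Rightarrow> 'k::field \<Rightarrow> 'k alg_closure vec set" where
  "axis i x = torus_class (\<lambda>k. if k = i then x else 1)"

lemma axis_eq_cox_orbit:
  assumes "i < n"
  shows "axis i x = cox_orbit \<Phi> (vec r (\<lambda>j. x powi A $$ (i, j)))"
proof -
  have "dual_point A n (\<lambda>k. if k = i then x else 1) = vec r (\<lambda>j. x powi A $$ (i, j))"
  proof (rule eq_vecI)
    fix j assume "j < dim_vec (vec r (\<lambda>j. x powi A $$ (i, j)))"
    moreover have "(\<Prod>k<n. (if k = i then x else 1) powi A $$ (k, j)) =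
        (\<Prod>k<n. if k = i then x powi A $$ (i, j) else 1)"
      by (rule prod.cong) auto
    ultimately show "dual_point A n (\<lambda>k. if k = i then x else 1) $ j =
        vec r (\<lambda>j. x powi A $$ (i, j)) $ j"
      using A assms by (simp add: dual_point_def)
  qed (use A in \<open>auto simp: dual_point_def\<close>)
  then show ?thesis by (simp add: axis_def torus_class_def)
qed

lemma axis_power_int_mem_subgroup:
  fixes x :: "'k::field"
  assumes J: "subgroup J (torus TYPE('k))" and mem: "axis i x \<in> J" and x: "x \<noteq> 0"
  shows "axis i (x powi m) \<in> J"
proof (induction m rule: int_induct[where k = 0])
  case base
  have "axis i (x powi 0) = \<one>\<^bsub>torus TYPE('k)\<^esub>" by (simp add: axis_def one_torus)
  then show ?case using subgroup.one_closed[OF J] by simp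
next
  case (step1 m)
  have "axis i (x powi (m + 1)) = axis i (x powi m) \<otimes>\<^bsub>torus TYPE('k)\<^esub> axis i x"
    unfolding axis_def mult_torus by (rule torus_class_cong) (simp add: power_int_add x)
  then show ?case using step1 subgroup.m_closed[OF J] mem by simp
next
  case (step2 m)
  have "axis i (x powi (m - 1)) = axis i (x powi m) \<otimes>\<^bsub>torus TYPE('k)\<^esub> inv\<^bsub>torus TYPE('k)\<^esub> axis i x"
  proof -
    have "inv\<^bsub>torus TYPE('k)\<^esub> axis i x = torus_class (\<lambda>k. inverse (if k = i then x else 1))"
      unfolding axis_def by (rule inv_torus) (simp add: x)
    then show ?thesis
      unfolding axis_def
      by (simp only: mult_torus, intro torus_class_cong) (simp add: power_int_diff x divide_inverse)
  qed
  then show ?case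
    using step2 subgroup.m_closed[OF J] subgroup.m_inv_closed[OF J] mem by simp
qed

text \<open>
  Every element is the product of its components on the axes; the product is formed one coordinate
  at a time.
\<close>

lemma torus_class_mem_subgroup:
  fixes \<zeta> :: "nat \<Rightarrow> 'k::field"
  assumes J: "subgroup J (torus TYPE('k))" and mem: "\<And>i. i < n \<Longrightarrow> axis i (\<zeta> i) \<in> J"
  shows "torus_class \<zeta> \<in> J"
proof -
  have "torus_class (\<lambda>i. if i < l then \<zeta> i else 1) \<in> J" if "l \<le> n" for l
    using that
  proof (induction l)
    case 0
    then show ?case using subgroup.one_closed[OF J] by (simp add: one_torus)
  next
    case (Suc l)
    have "torus_class (\<lambda>i. if i < Suc l then \<zeta> i else 1) =
          torus_class (\<lambda>i. if i < l then \<zeta> i else 1) \<otimes>\<^bsub>torus TYPE('k)\<^esub> axis l (\<zeta> l)"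
      unfolding axis_def mult_torus by (rule torus_class_cong) (auto simp: less_Suc_eq)
    then show ?case using Suc mem[of l] subgroup.m_closed[OF J] by simp
  qed
  from this[of n] show ?thesis
    using torus_class_cong[of "\<lambda>i. if i < n then \<zeta> i else 1" \<zeta>] by simp
qed

text \<open>
  An element of the box has coordinates \<open>\<eta>\<^sub>i\<close> to some powers, so it is a product of powers of the axis
  elements. For the trivial intersections, the group generated on the \<open>i\<close>-th axis lies in the
  subgroup of elements whose coordinates other than the \<open>i\<close>-th are \<open>1\<close>, while the remaining axes
  generate elements whose \<open>i\<close>-th coordinate is \<open>1\<close>.
\<close>

lemma internal_direct_product_box:
  fixes \<eta> :: "nat \<Rightarrow> 'k::field"
  assumes d: "\<And>i. i < n \<Longrightarrow> 0 < d i"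
    and \<eta>: "\<And>i. i < n \<Longrightarrow> generates_roots_of_unity (d i) (\<eta> i)"
  shows "internal_direct_product (torus TYPE('k)) (box (\<lambda>i z. z ^ d i = 1)) {..<n}
           (\<lambda>i. generate (torus TYPE('k)) {axis i (\<eta> i)})"
proof -
  let ?T = "torus TYPE('k)" and ?H = "box (\<lambda>i (z::'k). z ^ d i = 1)"
  let ?S = "\<lambda>i. generate ?T {axis i (\<eta> i)}"
  interpret T: comm_group ?T by (rule comm_group_torus)
  have \<eta>d: "\<eta> i ^ d i = 1" if "i < n" for i
    by (rule generates_roots_of_unity_power[OF \<eta>[OF that]])
  have \<eta>0: "\<eta> i \<noteq> 0" if "i < n" for i
    using \<eta>d[OF that] d[OF that] by (auto simp: power_0_left)
  have H: "subgroup ?H ?T"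
    by (rule subgroup_box) (auto simp: power_mult_distrib power_inverse)
  have axis_box: "axis i (\<eta> i) \<in> box S"
    if "i < n" "\<And>k. k < n \<Longrightarrow> k \<noteq> i \<Longrightarrow> S k 1" "S i (\<eta> i)" for i S
    unfolding box_def axis_def using that \<eta>0[OF that(1)]
    by (intro CollectI exI[of _ "\<lambda>k. if k = i then \<eta> i else 1"]) auto
  have axis_H: "axis i (\<eta> i) \<in> ?H" if "i < n" for i
    using axis_box[of i "\<lambda>i z. z ^ d i = 1"] \<eta>d that by simp
  have axis_T: "axis i (\<eta> i) \<in> carrier ?T" if "i < n" for i
    using axis_H[OF that] subgroup.subset[OF H] by blast
  have S_H: "?S i \<subseteq> ?H" if "i < n" for i
    using T.generate_subgroup_incl[OF _ H] axis_H[OF that] by simp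
  have S: "subgroup (?S i) ?T" if "i < n" for i
    using T.generate_is_subgroup axis_T[OF that] by simp
  have J: "subgroup (generate ?T (\<Union>j \<in> I. ?S j)) ?T" if "I \<subseteq> {..<n}" for I
    using that S_H subgroup.subset[OF H] by (intro T.generate_is_subgroup) blast
  have normal: "normal (?S i) (?T\<lparr>carrier := ?H\<rparr>)" if "i < n" for i
  proof -
    have "comm_group (?T\<lparr>carrier := ?H\<rparr>)"
      using T.subgroup_imp_group[OF H] subgroup.subset[OF H] T.m_comm
      by (intro group.group_comm_groupI) auto
    then show ?thesis
      using T.subgroup_incl[OF S[OF that] H S_H[OF that]] comm_group.subgroup_imp_normal by blast
  qed
  have gen: "?H = generate ?T (\<Union>i \<in> {..<n}. ?S i)" (is "_ = ?J")
  proof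
    show "?J \<subseteq> ?H" by (rule T.generate_subgroup_incl[OF _ H]) (use S_H in auto)
    show "?H \<subseteq> ?J"
    proof
      fix U assume "U \<in> ?H"
      then obtain \<zeta> where \<zeta>: "U = torus_class \<zeta>" "\<forall>i<n. \<zeta> i ^ d i = 1"
        by (auto simp: box_def)
      have "axis i (\<zeta> i) \<in> ?J" if i: "i < n" for i
      proof -
        have "\<zeta> i \<in> range (\<lambda>k::int. \<eta> i powi k)"
          using \<zeta>(2) \<eta>[OF i] i unfolding generates_roots_of_unity_def by blast
        then obtain k :: int where k: "\<zeta> i = \<eta> i powi k" by auto
        have "axis i (\<eta> i) \<in> ?J"
          using i by (intro generate.incl UN_I[of i]) (auto intro: generate.incl)
        then show ?thesis
          unfolding k by (intro axis_power_int_mem_subgroup[OF J _ \<eta>0[OF i]]) simp_all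
      qed
      then show "U \<in> ?J" unfolding \<zeta>(1) by (intro torus_class_mem_subgroup[OF J]) simp_all
    qed
  qed
  have meet: "?S i \<inter> generate ?T (\<Union>j \<in> {..<n} - {i}. ?S j) = {\<one>\<^bsub>?T\<^esub>}" if i: "i < n" for i
  proof
    have "subgroup (box (\<lambda>k (z::'k). k \<noteq> i \<longrightarrow> z = 1)) ?T"
      by (rule subgroup_box) auto
    then have 1: "?S i \<subseteq> box (\<lambda>k z. k \<noteq> i \<longrightarrow> z = 1)"
      using i by (intro T.generate_subgroup_incl) (auto intro: axis_box)
    have sub2: "subgroup (box (\<lambda>k (z::'k). k = i \<longrightarrow> z = 1)) ?T"
      by (rule subgroup_box) auto
    then have "?S j \<subseteq> box (\<lambda>k z. k = i \<longrightarrow> z = 1)" if "j < n" "j \<noteq> i" for j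
      using that by (intro T.generate_subgroup_incl) (auto intro: axis_box)
    then have 2: "generate ?T (\<Union>j \<in> {..<n} - {i}. ?S j) \<subseteq> box (\<lambda>k z. k = i \<longrightarrow> z = 1)"
      using sub2 by (intro T.generate_subgroup_incl) auto
    show "?S i \<inter> generate ?T (\<Union>j \<in> {..<n} - {i}. ?S j) \<subseteq> {\<one>\<^bsub>?T\<^esub>}"
    proof
      fix U assume "U \<in> ?S i \<inter> generate ?T (\<Union>j \<in> {..<n} - {i}. ?S j)"
      then have "U \<in> box (\<lambda>k z. k \<noteq> i \<longrightarrow> z = 1)" "U \<in> box (\<lambda>k z. k = i \<longrightarrow> z = 1)"
        using 1 2 by auto
      then obtain \<zeta> \<xi> :: "nat \<Rightarrow> 'k" where
        "U = torus_class \<zeta>" "\<forall>k<n. \<zeta> k \<noteq> 0 \<and> (k \<noteq> i \<longrightarrow> \<zeta> k = 1)"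
        "U = torus_class \<xi>" "\<forall>k<n. \<xi> k \<noteq> 0 \<and> (k = i \<longrightarrow> \<xi> k = 1)"
        unfolding box_def by blast
      moreover from this have "\<forall>k<n. \<zeta> k = \<xi> k" using torus_class_eq_iff[of \<zeta> \<xi>] by metis
      ultimately have "U = torus_class \<zeta>" "\<forall>k<n. \<zeta> k = 1" by metis+
      then have "U = \<one>\<^bsub>?T\<^esub>" unfolding one_torus by (simp, intro torus_class_cong) simp
      then show "U \<in> {\<one>\<^bsub>?T\<^esub>}" by simp
    qed
    show "{\<one>\<^bsub>?T\<^esub>} \<subseteq> ?S i \<inter> generate ?T (\<Union>j \<in> {..<n} - {i}. ?S j)"
      by (auto intro: generate.one)
  qed
  show ?thesis
    unfolding internal_direct_product_def
    using T.is_group H normal gen meet by auto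
qed

end

section \<open>Zeros of a lattice ideal lie in the torus\<close>

text \<open>
  The generators \<open>M\<close> are linearly independent, so the Gram matrix \<open>M\<^sup>T M\<close> is invertible and there is
  \<open>u = M y\<close> with value \<open>1\<close> on each generator. Its value on a point of the cone is then the sum of the
  coefficients of that point.
\<close>

lemma simplicial_cone_positive_functional:
  assumes "simplicial_cone n \<sigma>"
  obtains u where "u \<in> carrier_vec n"
    "\<And>x. x \<in> \<sigma> \<Longrightarrow> x \<noteq> 0\<^sub>v n \<Longrightarrow> 0 < u \<bullet> x"
proof -
  obtain k M where M: "M \<in> carrier_mat n k" and ker: "mat_kernel M = {0\<^sub>v k}" and \<sigma>: "\<sigma> = col_cone M"
    using assms by (auto simp: simplicial_cone_def)
  let ?G = "transpose_mat M * M"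
  have G: "?G \<in> carrier_mat k k" using M by simp
  have "det ?G \<noteq> 0"
  proof
    assume "det ?G = 0"
    then obtain c where c: "c \<in> carrier_vec k" "c \<noteq> 0\<^sub>v k" "?G *\<^sub>v c = 0\<^sub>v k"
      using det_0_iff_vec_prod_zero[OF G] by auto
    have Mc: "M *\<^sub>v c \<in> carrier_vec n" using M c by simp
    have "(M *\<^sub>v c) \<bullet> (M *\<^sub>v c) = (transpose_mat M *\<^sub>v (M *\<^sub>v c)) \<bullet> c"
      using transpose_vec_mult_scalar[OF M c(1) Mc] by simp
    also have "transpose_mat M *\<^sub>v (M *\<^sub>v c) = ?G *\<^sub>v c"
      using M c by (intro assoc_mult_mat_vec[symmetric]) auto
    also have "\<dots> \<bullet> c = 0" using c by simp
    finally have "M *\<^sub>v c = 0\<^sub>v n"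
      using Mc conjugate_square_eq_0_vec[OF Mc] by (simp add: conjugate_vec_def)
    then have "c \<in> mat_kernel M" using M c by (auto simp: mat_kernel)
    then show False using ker c by simp
  qed
  then obtain G' where G': "G' \<in> carrier_mat k k" "?G * G' = 1\<^sub>m k"
    using det_non_zero_imp_unit[OF G] unfolding Units_def ring_mat_def by auto
  define y where "y = G' *\<^sub>v vec k (\<lambda>_. 1)"
  have y: "y \<in> carrier_vec k" using G' by (simp add: y_def)
  have Gy: "?G *\<^sub>v y = vec k (\<lambda>_. 1)"
    unfolding y_def using G G' by (subst assoc_mult_mat_vec[symmetric, OF G]) auto
  show ?thesis
  proof
    show u: "M *\<^sub>v y \<in> carrier_vec n" using M y by simp
    fix x assume x: "x \<in> \<sigma>" "x \<noteq> 0\<^sub>v n"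
    then obtain c :: "real vec" where c: "x = M *\<^sub>v c" "c \<in> carrier_vec k" "\<And>i. i < k \<Longrightarrow> 0 \<le> c $ i"
      using M by (auto simp: \<sigma> col_cone_def)
    have "(M *\<^sub>v y) \<bullet> x = (transpose_mat M *\<^sub>v (M *\<^sub>v y)) \<bullet> c"
      using transpose_vec_mult_scalar[OF M c(2) u] c(1) by simp
    also have "transpose_mat M *\<^sub>v (M *\<^sub>v y) = ?G *\<^sub>v y"
      using M y by (intro assoc_mult_mat_vec[symmetric]) auto
    also have "\<dots> \<bullet> c = (\<Sum>i<k. c $ i)"
      using c(2) by (simp add: Gy scalar_prod_def atLeast0LessThan)
    finally have eq: "(M *\<^sub>v y) \<bullet> x = (\<Sum>i<k. c $ i)" .
    have "\<exists>i<k. c $ i \<noteq> 0"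
    proof (rule ccontr)
      assume "\<not> (\<exists>i<k. c $ i \<noteq> 0)"
      then have "c = 0\<^sub>v k" using c(2) by (intro eq_vecI) auto
      then show False using x c(1) mult_mat_zero_vec[OF M] by simp
    qed
    then obtain i where "i < k" "c $ i \<noteq> 0" by blast
    then have "0 < c $ i" using c(3)[of i] by simp
    then have "0 < (\<Sum>i<k. c $ i)" using c(3) \<open>i < k\<close> by (intro sum_pos2[of _ i]) auto
    then show "0 < (M *\<^sub>v y) \<bullet> x" using eq by simp
  qed
qed

text \<open>
  Scale \<open>u\<close> by a large \<open>N\<close> and round down. Rounding changes the value on \<open>v\<^sub>i\<close> by at most the sum \<open>s\<^sub>i\<close> of
  the absolute values of its entries.
\<close>

lemma integral_positive_functional:
  fixes u :: "real vec" and v :: "'i \<Rightarrow> int vec"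
  assumes fin: "finite Z" and u: "u \<in> carrier_vec n"
    and v: "\<And>i. i \<in> Z \<Longrightarrow> v i \<in> carrier_vec n"
    and pos: "\<And>i. i \<in> Z \<Longrightarrow> 0 < u \<bullet> map_vec real_of_int (v i)"
  obtains w where "w \<in> carrier_vec n" "\<And>i. i \<in> Z \<Longrightarrow> 0 < v i \<bullet> w"
proof -
  define c where "c i = u \<bullet> map_vec real_of_int (v i)" for i
  define s where "s i = (\<Sum>j<n. \<bar>real_of_int (v i $ j)\<bar>)" for i
  \<comment> \<open>Large enough for \<open>s\<^sub>i < N c\<^sub>i\<close> to hold for all \<open>i\<close> at once.\<close>
  define N where "N = (\<Sum>i \<in> Z. s i / c i) + 1"
  have N: "s i < N * c i" if "i \<in> Z" for i
  proof -
    have "s i / c i \<le> (\<Sum>i \<in> Z. s i / c i)"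
      using fin that pos by (intro member_le_sum) (auto simp: s_def c_def less_imp_le sum_nonneg)
    then have "s i / c i < N" by (simp add: N_def)
    then show ?thesis using pos[OF that] by (simp add: c_def divide_simps)
  qed
  define w where "w = vec n (\<lambda>j. \<lfloor>N * u $ j\<rfloor>)"
  show ?thesis
  proof
    show "w \<in> carrier_vec n" by (simp add: w_def)
    fix i assume i: "i \<in> Z"
    have "N * c i - s i = (\<Sum>j<n. N * u $ j * real_of_int (v i $ j) - \<bar>real_of_int (v i $ j)\<bar>)"
      using v[OF i] u
      by (simp add: c_def s_def scalar_prod_def atLeast0LessThan sum_distrib_left sum_subtractf mult.assoc)
    also have "\<dots> \<le> (\<Sum>j<n. real_of_int (v i $ j) * real_of_int \<lfloor>N * u $ j\<rfloor>)"
    proof (rule sum_mono)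
      fix j
      let ?x = "real_of_int (v i $ j)" and ?f = "N * u $ j - real_of_int \<lfloor>N * u $ j\<rfloor>"
      have "\<bar>?f\<bar> \<le> 1" by linarith
      then have "?f * ?x \<le> \<bar>?x\<bar>"
        using mult_right_mono[of "\<bar>?f\<bar>" 1 "\<bar>?x\<bar>"] abs_ge_self[of "?f * ?x"] by (simp add: abs_mult)
      then show "N * u $ j * ?x - \<bar>?x\<bar> \<le> ?x * real_of_int \<lfloor>N * u $ j\<rfloor>"
        by (simp add: algebra_simps)
    qed
    also have "\<dots> = real_of_int (v i \<bullet> w)"
      using v[OF i] by (simp add: w_def scalar_prod_def atLeast0LessThan)
    finally show "0 < v i \<bullet> w" using N[OF i] by linarith
  qed
qed

lemma map_vec_of_int_eq_0_iff:
  "v \<in> carrier_vec n \<Longrightarrow> map_vec real_of_int v = 0\<^sub>v n \<longleftrightarrow> v = 0\<^sub>v n"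
  by (auto simp: vec_eq_iff)

lemma cone_generator_in_carrier_cox_ring:
  "(\<Prod>i \<in> {i. i < r \<and> Q i}. Poly_Mapping.single (Poly_Mapping.single i 1) 1) \<in> carrier (cox_ring r :: 'k::field cox_poly ring)"
proof -
  interpret R: ring "cox_ring r :: 'k cox_poly ring" by (rule ring_cox_ring)
  have "(\<Prod>i \<in> I. Poly_Mapping.single (Poly_Mapping.single i 1) 1) \<in> carrier (cox_ring r :: 'k cox_poly ring)"
    if "finite I" "I \<subseteq> {..<r}" for I :: "nat set"
    using that
  proof (induction I)
    case empty
    then show ?case using R.one_closed by (simp add: cox_ring_def)
  next
    case (insert i I)
    have "(Poly_Mapping.single (Poly_Mapping.single i 1) 1 :: 'k cox_poly) \<in> carrier (cox_ring r)"
      using insert.prems by (simp add: cox_ring_def)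
    from R.m_closed[OF this insert.IH] insert.prems show ?case
      using insert.hyps by (simp add: cox_ring_def)
  qed
  from this[of "{i. i < r \<and> Q i}"] show ?thesis by (simp add: subset_eq)
qed

lemma poly_eval_cone_generator:
  assumes "dim_vec P = r"
  shows "poly_eval (\<Prod>i \<in> {i. i < r \<and> Q i}. Poly_Mapping.single (Poly_Mapping.single i 1) 1) P
         = (\<Prod>i \<in> {i. i < r \<and> Q i}. P $ i)"
  using assms by (simp add: poly_eval_prod monomial_eval_single)

text \<open>
  A point avoids \<open>V(B)\<close> if and only if some monomial generator of \<open>B\<close> does not vanish there: its
  vanishing coordinates then belong to rays of one cone.
\<close>

lemma semistable_points_iff:
  fixes P :: "'k::field vec"
  assumes "dim_row \<Phi> = r"
  shows "P \<in> semistable_points \<Phi> \<Sigma> \<longleftrightarrow>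
    P \<in> carrier_vec r \<and> (\<exists>\<sigma> \<in> \<Sigma>. \<forall>i<r. \<not> row_ray \<Phi> i \<subseteq> \<sigma> \<longrightarrow> P $ i \<noteq> 0)"
proof (cases "P \<in> carrier_vec r")
  case P: True
  let ?g = "\<lambda>\<sigma>. \<Prod>i \<in> {i. i < r \<and> \<not> row_ray \<Phi> i \<subseteq> \<sigma>}.
    Poly_Mapping.single (Poly_Mapping.single i 1) (1 :: 'k)"
  have I: "irrelevant_ideal \<Phi> \<Sigma> = genideal (cox_ring r) (?g ` \<Sigma>)"
    by (simp add: irrelevant_ideal_def assms)
  have "(\<forall>F \<in> irrelevant_ideal \<Phi> \<Sigma>. poly_eval F P = 0) \<longleftrightarrow> (\<forall>\<sigma> \<in> \<Sigma>. poly_eval (?g \<sigma>) P = 0)"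
  proof
    assume zero: "\<forall>\<sigma> \<in> \<Sigma>. poly_eval (?g \<sigma>) P = 0"
    have carrier: "?g ` \<Sigma> \<subseteq> carrier (cox_ring r)"
      by (intro image_subsetI cone_generator_in_carrier_cox_ring)
    show "\<forall>F \<in> irrelevant_ideal \<Phi> \<Sigma>. poly_eval F P = 0"
    proof
      fix F :: "'k cox_poly" assume "F \<in> irrelevant_ideal \<Phi> \<Sigma>"
      from this[unfolded I] carrier show "poly_eval F P = 0"
        by (rule poly_eval_genideal_eq_0) (use zero in blast)
    qed
  next
    assume "\<forall>F \<in> irrelevant_ideal \<Phi> \<Sigma>. poly_eval F P = 0"
    moreover have "?g \<sigma> \<in> irrelevant_ideal \<Phi> \<Sigma>" if "\<sigma> \<in> \<Sigma>" for \<sigma>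
      unfolding I genideal_def using that by blast
    ultimately show "\<forall>\<sigma> \<in> \<Sigma>. poly_eval (?g \<sigma>) P = 0" by blast
  qed
  moreover have "poly_eval (?g \<sigma>) P \<noteq> 0 \<longleftrightarrow> (\<forall>i<r. \<not> row_ray \<Phi> i \<subseteq> \<sigma> \<longrightarrow> P $ i \<noteq> 0)" for \<sigma>
    using P by (subst poly_eval_cone_generator) auto
  ultimately show ?thesis using P unfolding semistable_points_def assms by blast
qed (simp add: semistable_points_def assms)

text \<open>
  Zeros in the toric variety are tested on homogeneous polynomials only, so the binomials have to be
  homogeneous to be usable; they are, because \<open>m\<^sup>+ - m\<^sup>- = m\<close> has degree \<open>0\<close>.
\<close>

lemma homogeneous_lattice_binomial:
  assumes beta: "\<beta> \<in> carrier_mat s r" and m: "m \<in> mat_kernel \<beta>"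
  shows "homogeneous \<beta> (Poly_Mapping.single (pos_part m) 1 - Poly_Mapping.single (pos_part (- m)) (1::'k::field))"
proof -
  have cm: "m \<in> carrier_vec r" and bm: "\<beta> *\<^sub>v m = 0\<^sub>v s" using m beta by (auto simp: mat_kernel)
  let ?e = "\<lambda>f. vec r (\<lambda>j. int (Poly_Mapping.lookup f j))"
  have "?e (pos_part m) = ?e (pos_part (- m)) + m"
    using cm by (auto simp: lookup_pos_part intro!: eq_vecI)
  then have "\<beta> *\<^sub>v ?e (pos_part m) = \<beta> *\<^sub>v ?e (pos_part (- m)) + \<beta> *\<^sub>v m"
    using beta cm by (simp add: mult_add_distrib_mat_vec[OF beta])
  also have "\<dots> = \<beta> *\<^sub>v ?e (pos_part (- m))" using beta bm by simp
  finally have eq: "\<beta> *\<^sub>v ?e (pos_part m) = \<beta> *\<^sub>v ?e (pos_part (- m))" .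
  have "Poly_Mapping.keys (Poly_Mapping.single (pos_part m) 1 - Poly_Mapping.single (pos_part (- m)) (1::'k))
      \<subseteq> {pos_part m, pos_part (- m)}"
    by (auto simp: in_keys_iff lookup_minus lookup_single when_def split: if_splits)
  moreover have "\<beta> *\<^sub>v vec (dim_col \<beta>) (\<lambda>j. int (Poly_Mapping.lookup f j)) = \<beta> *\<^sub>v ?e (pos_part m)"
    if "f \<in> {pos_part m, pos_part (- m)}" for f
    using that beta eq by auto
  ultimately show ?thesis
    unfolding homogeneous_def by blast
qed

text \<open>
  If some coordinates of \<open>P\<close> vanish, an integral functional \<open>w\<close> that is positive on the corresponding
  rays gives \<open>m = k \<Phi> w\<close> in \<open>L\<close> with positive entries at all vanishing coordinates. So \<open>m\<^sup>-\<close> involves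
  nonvanishing coordinates only, whereas \<open>m\<^sup>+\<close> involves a vanishing one.
\<close>

lemma lattice_zero_in_torus:
  fixes P :: "'k::field vec"
  assumes Phi: "\<Phi> \<in> carrier_mat r n" and fan: "complete_simplicial_fan n \<Sigma>"
    and rays: "primitive_ray_generators \<Phi> \<Sigma>"
    and k: "0 < k" "\<And>m. m \<in> int_image \<Phi> \<Longrightarrow> k \<cdot>\<^sub>v m \<in> L"
    and P: "P \<in> semistable_points \<Phi> \<Sigma>"
    and zero: "\<And>m. m \<in> L \<Longrightarrow>
      monomial_eval (pos_part m) P = monomial_eval (pos_part (- m)) P"
  shows "P \<in> torus_points r"
proof (rule ccontr)
  assume "P \<notin> torus_points r"
  moreover obtain \<sigma> where cP: "P \<in> carrier_vec r"
    and \<sigma>: "\<sigma> \<in> \<Sigma>" "\<And>i. i < r \<Longrightarrow> P $ i = 0 \<Longrightarrow> row_ray \<Phi> i \<subseteq> \<sigma>"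
    using P Phi by (subst (asm) semistable_points_iff) auto
  ultimately obtain i where i: "i < r" "P $ i = 0" by (auto simp: torus_points_def)
  define Z where "Z = {i. i < r \<and> P $ i = 0}"
  obtain u where u: "u \<in> carrier_vec n" "\<And>x. x \<in> \<sigma> \<Longrightarrow> x \<noteq> 0\<^sub>v n \<Longrightarrow> 0 < u \<bullet> x"
    using simplicial_cone_positive_functional fan \<sigma>(1) unfolding complete_simplicial_fan_def by metis
  have row: "row \<Phi> j \<in> carrier_vec n" if "j \<in> Z" for j using that Phi by (auto simp: Z_def)
  have "0 < u \<bullet> map_vec real_of_int (row \<Phi> j)" if "j \<in> Z" for j
  proof (rule u(2))
    have "map_vec real_of_int (row \<Phi> j) = 1 \<cdot>\<^sub>v map_vec real_of_int (row \<Phi> j)" by simp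
    then have "map_vec real_of_int (row \<Phi> j) \<in> row_ray \<Phi> j"
      unfolding row_ray_def by (intro CollectI exI[of _ 1]) simp
    then show "map_vec real_of_int (row \<Phi> j) \<in> \<sigma>" using \<sigma>(2) that by (auto simp: Z_def)
    have gcd: "Gcd (set\<^sub>v (row \<Phi> j)) = 1"
      using rays Phi that by (auto simp: primitive_ray_generators_def Z_def)
    have "row \<Phi> j \<noteq> 0\<^sub>v n"
    proof
      assume "row \<Phi> j = 0\<^sub>v n"
      then have "set\<^sub>v (row \<Phi> j) \<subseteq> {0}" by (auto simp: vec_set_def)
      then have "Gcd (set\<^sub>v (row \<Phi> j)) = 0" by (simp add: Gcd_0_iff)
      then show False using gcd by simp
    qed
    then show "map_vec real_of_int (row \<Phi> j) \<noteq> 0\<^sub>v n"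
      using map_vec_of_int_eq_0_iff[OF row[OF that]] by simp
  qed
  then obtain w where w: "w \<in> carrier_vec n" "\<And>j. j \<in> Z \<Longrightarrow> 0 < row \<Phi> j \<bullet> w"
    using integral_positive_functional[of Z u n "row \<Phi>"] u(1) row by (auto simp: Z_def)
  define m where "m = k \<cdot>\<^sub>v (\<Phi> *\<^sub>v w)"
  have cm: "m \<in> carrier_vec r" using Phi w by (simp add: m_def)
  have "m \<in> L" unfolding m_def using k(2) w(1) mem_int_image[OF Phi] by blast
  have pos: "0 < m $ j" if "j \<in> Z" for j
    using that w k Phi by (auto simp: m_def Z_def)
  have "monomial_eval (pos_part m) P = 0"
    unfolding monomial_eval_def using i cP cm pos[of i]
    by (intro prod_zero bexI[of _ i]) (auto simp: Z_def lookup_pos_part)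
  moreover have "monomial_eval (pos_part (- m)) P \<noteq> 0"
  proof -
    have "P $ j ^ Poly_Mapping.lookup (pos_part (- m)) j \<noteq> 0" if "j < r" for j
      using that pos[of j] cm by (cases "j \<in> Z") (auto simp: Z_def lookup_pos_part)
    then show ?thesis using cP by (simp add: monomial_eval_def)
  qed
  ultimately show False using zero[OF \<open>m \<in> L\<close>] by simp
qed

text \<open>
  The binomials are homogeneous, so their vanishing is a necessary condition, and they generate the
  ideal, so on the torus it is also sufficient.
\<close>

lemma variety_zeros_lattice_ideal:
  assumes Phi: "\<Phi> \<in> carrier_mat r n" and fan: "complete_simplicial_fan n \<Sigma>"
    and rays: "primitive_ray_generators \<Phi> \<Sigma>"
    and beta: "\<beta> \<in> carrier_mat s r" and L: "L \<subseteq> mat_kernel \<beta>"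
    and k: "0 < k" "\<And>m. m \<in> int_image \<Phi> \<Longrightarrow> k \<cdot>\<^sub>v m \<in> L"
  shows "variety_zeros \<Phi> \<Sigma> \<beta> (lattice_ideal r L :: 'k::field cox_poly set) =
    {cox_orbit \<Phi> P | P. P \<in> torus_points r \<and> (\<forall>m \<in> L. laurent_monomial m P = 1)}"
proof -
  let ?b = "\<lambda>m. Poly_Mapping.single (pos_part m) 1 - Poly_Mapping.single (pos_part (- m)) (1::'k)"
  have I: "lattice_ideal r L = genideal (cox_ring r) (?b ` L)"
    by (simp add: lattice_ideal_def)
  have cL: "m \<in> carrier_vec r" if "m \<in> L" for m using that L beta by (auto simp: mat_kernel)
  have binomials: "?b ` L \<subseteq> carrier (cox_ring r)"
  proof
    fix F assume "F \<in> ?b ` L"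
    then obtain m where m: "m \<in> L" "F = ?b m" by blast
    have "Poly_Mapping.keys (?b m) \<subseteq> {pos_part m, pos_part (- m)}"
      by (auto simp: in_keys_iff lookup_minus lookup_single when_def split: if_splits)
    moreover have "Poly_Mapping.keys (pos_part m) \<subseteq> {..<r}" "Poly_Mapping.keys (pos_part (- m)) \<subseteq> {..<r}"
      using keys_pos_part[of m] keys_pos_part[of "- m"] cL[OF m(1)] by auto
    ultimately show "F \<in> carrier (cox_ring r)" unfolding cox_ring_def m(2) by auto
  qed
  have "(P \<in> semistable_points \<Phi> \<Sigma> \<and> (\<forall>F \<in> lattice_ideal r L. homogeneous \<beta> F \<longrightarrow> poly_eval F P = 0))
      \<longleftrightarrow> (P \<in> torus_points r \<and> (\<forall>m \<in> L. laurent_monomial m P = 1))" (is "?lhs \<longleftrightarrow> ?rhs") for P :: "'k vec"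
  proof
    assume P: ?lhs
    have zero: "monomial_eval (pos_part m) P = monomial_eval (pos_part (- m)) P" if "m \<in> L" for m
    proof -
      have "?b m \<in> lattice_ideal r L" unfolding I genideal_def using that by blast
      moreover have "homogeneous \<beta> (?b m)" using homogeneous_lattice_binomial[OF beta] L that by blast
      ultimately have "poly_eval (?b m) P = 0" using P by blast
      then show ?thesis by (simp add: poly_eval_diff)
    qed
    have torus: "P \<in> torus_points r"
      by (rule lattice_zero_in_torus[OF Phi fan rays k _ zero]) (use P in simp_all)
    moreover have "laurent_monomial m P = 1" if "m \<in> L" for m
      using laurent_monomial_eq_1_iff[OF torus cL[OF that]] zero[OF that] by simp
    ultimately show ?rhs by blast
  next
    assume P: ?rhs
    have "0\<^sub>v n \<in> \<Union>\<Sigma>" using fan by (simp add: complete_simplicial_fan_def)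
    then have "\<Sigma> \<noteq> {}" by blast
    then have "P \<in> semistable_points \<Phi> \<Sigma>"
      using P Phi by (subst semistable_points_iff) (auto simp: torus_points_def)
    moreover have "poly_eval F P = 0" if "F \<in> lattice_ideal r L" for F
    proof (rule poly_eval_genideal_eq_0[OF that[unfolded I] binomials])
      fix G assume "G \<in> ?b ` L"
      then show "poly_eval G P = 0"
        using P laurent_monomial_eq_1_iff[of P r] cL by (auto simp: poly_eval_diff)
    qed
    ultimately show ?lhs by blast
  qed
  then show ?thesis unfolding variety_zeros_def by simp
qed

section \<open>Roots of unity in a finite field\<close>

lemma card_power_eq_le:
  fixes z :: "'k::field"
  assumes "0 < e"
  shows "card {t. t ^ e = z} \<le> e"
proof -
  let ?p = "Polynomial.monom 1 e + [:- z:]"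
  have deg: "Polynomial.degree ?p = e"
    using assms by (subst degree_add_eq_left) (auto simp: degree_monom_eq)
  then have "?p \<noteq> 0" using assms by auto
  then have "card {t. poly ?p t = 0} \<le> e" using card_poly_roots_bound[of ?p] deg by simp
  then show ?thesis by (simp add: poly_monom)
qed

text \<open>
  Multiplication by \<open>x\<close> permutes the nonzero elements, so it does not change their product.
\<close>

lemma finite_field_power_card_minus_1:
  fixes x :: "'k::field"
  assumes fin: "finite (UNIV :: 'k set)" and x: "x \<noteq> 0"
  shows "x ^ (card (UNIV :: 'k set) - 1) = 1"
proof -
  have "(\<Prod>y\<in>UNIV-{0}. y) = (\<Prod>y\<in>UNIV-{0}. x * y)"
    by (rule prod.reindex_bij_witness[of _ "\<lambda>y. x * y" "\<lambda>y. y / x"]) (use x in auto)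
  also have "\<dots> = x ^ (card (UNIV :: 'k set) - 1) * (\<Prod>y\<in>UNIV-{0}. y)"
    using fin by (simp add: prod.distrib)
  finally show ?thesis using fin by simp
qed

text \<open>
  A counting argument. With \<open>q\<close> the number of elements and \<open>d e = q - 1\<close>, the map sending \<open>t\<close> to its \<open>e\<close>-th
  power has fibres of at most \<open>e\<close> elements on the \<open>q - 1\<close> nonzero elements, so its image has at least
  \<open>d\<close> elements. These are \<open>d\<close>-th roots of unity, of which there are at most \<open>d\<close>.
\<close>

lemma root_of_unity_is_power:
  fixes z :: "'k::field"
  assumes fin: "finite (UNIV :: 'k set)" and d: "d dvd card (UNIV :: 'k set) - 1" and z: "z ^ d = 1"
  obtains t where "t \<noteq> 0" "t ^ ((card (UNIV :: 'k set) - 1) div d) = z"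
proof -
  let ?q = "card (UNIV :: 'k set) - 1"
  define e where "e = ?q div d"
  have "card {0, 1 :: 'k} \<le> card (UNIV :: 'k set)" using fin by (intro card_mono) auto
  then have q: "0 < ?q" by simp
  have de: "d * e = ?q" using d by (simp add: e_def)
  then have "0 < d * e" using q by (simp only:)
  then have "0 < d" "0 < e" by simp_all
  let ?U = "UNIV - {0 :: 'k}"
  let ?I = "(\<lambda>t. t ^ e) ` ?U"
  have finI: "finite A" for A :: "'k set" by (rule finite_subset[OF subset_UNIV fin])
  have "card ?U \<le> card (\<Union>w \<in> ?I. {t \<in> ?U. t ^ e = w})"
    by (rule card_mono[OF finI]) blast
  also have "\<dots> \<le> (\<Sum>w \<in> ?I. card {t \<in> ?U. t ^ e = w})"
    by (rule card_UN_le[OF finI])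
  also have "\<dots> \<le> (\<Sum>w \<in> ?I. e)"
  proof (rule sum_mono)
    fix w
    have "card {t \<in> ?U. t ^ e = w} \<le> card {t. t ^ e = w}" by (rule card_mono[OF finI]) auto
    then show "card {t \<in> ?U. t ^ e = w} \<le> e" using card_power_eq_le[OF \<open>0 < e\<close>, of w] by simp
  qed
  also have "\<dots> = card ?I * e" by simp
  also have "card ?U = d * e" using fin unfolding de by (simp add: card_Diff_singleton)
  finally have "d * e \<le> card ?I * e" .
  then have "d \<le> card ?I" using \<open>0 < e\<close> by simp
  moreover have "?I \<subseteq> {w. w ^ d = 1}"
  proof
    fix w assume "w \<in> ?I"
    then obtain t where "t \<noteq> 0" "w = t ^ e" by blast
    then have "w ^ d = t ^ ?q" by (simp only: de[symmetric] mult.commute[of d e] power_mult)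
    then show "w \<in> {w. w ^ d = 1}"
      using finite_field_power_card_minus_1[OF fin \<open>t \<noteq> 0\<close>] by simp
  qed
  ultimately have "?I = {w. w ^ d = 1}"
    using card_power_eq_le[OF \<open>0 < d\<close>, of "1 :: 'k"] by (intro card_seteq[OF finI]) simp_all
  then have "z \<in> ?I" using z by blast
  then show ?thesis using that unfolding e_def by blast
qed

section \<open>The zero set in coordinates\<close>

context torus_coordinates
begin

text \<open>
  The lattice has the basis \<open>d\<^sub>j w\<^sub>j\<close>, on which triviality of the character says that the \<open>j\<close>-th coordinate
  is a \<open>d\<^sub>j\<close>-th root of unity.
\<close>

lemma lattice_orbits_eq_box:
  fixes d :: "nat \<Rightarrow> nat"
  assumes L: "L = int_image (mat r n (\<lambda>(i, j). int (d j) * W $$ (i, j)))"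
  shows "{cox_orbit \<Phi> P | P :: 'k::field vec. P \<in> torus_points r \<and> (\<forall>m \<in> L. laurent_monomial m P = 1)}
    = box (\<lambda>i z. z ^ d i = 1)"
proof -
  let ?W = "mat r n (\<lambda>(i, j). int (d j) * W $$ (i, j))"
  have "laurent_monomial (col ?W j) P = laurent_monomial (col W j) P ^ d j" if "j < n" for j and P :: "'k vec"
    using that W by (simp add: laurent_monomial_def prod_power_distrib power_int_power' mult.commute)
  then have iff: "(\<forall>m \<in> L. laurent_monomial m P = 1) \<longleftrightarrow> (\<forall>j<n. laurent_monomial (col W j) P ^ d j = 1)"
    if "P \<in> torus_points r" for P :: "'k vec"
    unfolding L using laurent_monomial_eq_1_on_int_image[OF that, of ?W n] by simp
  show ?thesis
  proof (intro equalityI subsetI)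
    fix U assume "U \<in> {cox_orbit \<Phi> P | P :: 'k vec. P \<in> torus_points r \<and> (\<forall>m \<in> L. laurent_monomial m P = 1)}"
    then obtain P :: "'k vec" where P: "P \<in> torus_points r" "U = cox_orbit \<Phi> P"
      "\<forall>j<n. laurent_monomial (col W j) P ^ d j = 1"
      using iff by auto
    then show "U \<in> box (\<lambda>i z. z ^ d i = 1)"
      unfolding box_def P(2) cox_orbit_eq_torus_class[OF P(1)]
      using laurent_monomial_nonzero[OF P(1) col_W] by blast
  next
    fix U :: "'k alg_closure vec set" assume "U \<in> box (\<lambda>i z. z ^ d i = 1)"
    then obtain \<zeta> where \<zeta>: "U = torus_class \<zeta>" "\<forall>i<n. \<zeta> i \<noteq> 0 \<and> \<zeta> i ^ d i = 1"
      by (auto simp: box_def)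
    then have torus: "dual_point A n \<zeta> \<in> torus_points r" by (intro dual_point_torus) simp
    moreover have "\<forall>m \<in> L. laurent_monomial m (dual_point A n \<zeta>) = 1"
      unfolding iff[OF torus] using \<zeta>(2) by (simp add: laurent_monomial_dual_point)
    ultimately show "U \<in> {cox_orbit \<Phi> P | P :: 'k vec. P \<in> torus_points r \<and> (\<forall>m \<in> L. laurent_monomial m P = 1)}"
      unfolding \<zeta>(1) torus_class_def by blast
  qed
qed

text \<open>
  Scaling row \<open>i\<close> of \<open>A\<close> by \<open>e\<^sub>i\<close> amounts to raising the \<open>i\<close>-th coordinate to the power \<open>e\<^sub>i\<close>.
\<close>

lemma parametrized_set_eq:
  "(parametrized_set \<Phi> (mat n r (\<lambda>(i, j). int (e i) * A $$ (i, j))) :: 'k::field alg_closure vec set set)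
   = {torus_class (\<lambda>i. t i ^ e i) | t. \<forall>i<n. t i \<noteq> 0}"
proof -
  let ?Q = "mat n r (\<lambda>(i, j). int (e i) * A $$ (i, j))"
  have point: "cox_orbit \<Phi> (vec (dim_col ?Q) (\<lambda>j. laurent_monomial (col ?Q j) t)) =
        torus_class (\<lambda>i. t $ i ^ e i)" for t :: "'k vec"
  proof -
    have "vec (dim_col ?Q) (\<lambda>j. laurent_monomial (col ?Q j) t) = dual_point A n (\<lambda>i. t $ i ^ e i)"
      using A by (auto simp: dual_point_def laurent_monomial_def power_int_power intro!: eq_vecI)
    then show ?thesis by (simp add: torus_class_def)
  qed
  show ?thesis
  proof (intro equalityI subsetI)
    fix U :: "'k alg_closure vec set" assume "U \<in> parametrized_set \<Phi> ?Q"
    then obtain t :: "'k vec" where "U = torus_class (\<lambda>i. t $ i ^ e i)" "t \<in> torus_points n"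
      unfolding parametrized_set_def point by auto
    then show "U \<in> {torus_class (\<lambda>i. t i ^ e i) | t. \<forall>i<n. t i \<noteq> 0}"
      by (auto simp: torus_points_def intro!: exI[of _ "\<lambda>i. t $ i"])
  next
    fix U assume "U \<in> {torus_class (\<lambda>i. t i ^ e i) | t :: nat \<Rightarrow> 'k. \<forall>i<n. t i \<noteq> 0}"
    then obtain t :: "nat \<Rightarrow> 'k" where t: "U = torus_class (\<lambda>i. t i ^ e i)" "\<forall>i<n. t i \<noteq> 0" by blast
    have "U = torus_class (\<lambda>i. vec n t $ i ^ e i)"
      unfolding t(1) by (rule torus_class_cong) simp
    moreover have "vec n t \<in> torus_points (dim_row ?Q)" using t(2) by (simp add: torus_points_def)
    ultimately show "U \<in> parametrized_set \<Phi> ?Q" unfolding parametrized_set_def point by blast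
  qed
qed

lemma box_eq_parametrized_set:
  fixes d :: "nat \<Rightarrow> nat"
  assumes fin: "finite (UNIV :: 'k::field set)"
    and d: "\<And>i. i < n \<Longrightarrow> d i dvd card (UNIV :: 'k set) - 1"
  shows "box (\<lambda>i (z::'k). z ^ d i = 1) =
    parametrized_set \<Phi> (mat n r (\<lambda>(i, j). int ((card (UNIV :: 'k set) - 1) div d i) * A $$ (i, j)))"
  unfolding parametrized_set_eq
proof (intro equalityI subsetI)
  let ?e = "\<lambda>i. (card (UNIV :: 'k set) - 1) div d i"
  fix U assume "U \<in> box (\<lambda>i (z::'k). z ^ d i = 1)"
  then obtain \<zeta> :: "nat \<Rightarrow> 'k" where \<zeta>: "U = torus_class \<zeta>" "\<forall>i<n. \<zeta> i ^ d i = 1"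
    by (auto simp: box_def)
  have "\<exists>t. t \<noteq> 0 \<and> t ^ ?e i = \<zeta> i" if "i < n" for i
    using root_of_unity_is_power[OF fin d[OF that], of "\<zeta> i"] \<zeta>(2) that by metis
  then obtain t where t: "\<And>i. i < n \<Longrightarrow> t i \<noteq> 0 \<and> t i ^ ?e i = \<zeta> i" by metis
  then have "U = torus_class (\<lambda>i. t i ^ ?e i)" unfolding \<zeta>(1) by (intro torus_class_cong) simp
  then show "U \<in> {torus_class (\<lambda>i. t i ^ ?e i) | t. \<forall>i<n. t i \<noteq> 0}" using t by blast
next
  let ?e = "\<lambda>i. (card (UNIV :: 'k set) - 1) div d i"
  fix U assume "U \<in> {torus_class (\<lambda>i. t i ^ ?e i) | t :: nat \<Rightarrow> 'k. \<forall>i<n. t i \<noteq> 0}"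
  then obtain t :: "nat \<Rightarrow> 'k" where t: "U = torus_class (\<lambda>i. t i ^ ?e i)" "\<forall>i<n. t i \<noteq> 0" by blast
  have "(t i ^ ?e i) ^ d i = 1" if "i < n" for i
    using finite_field_power_card_minus_1[OF fin, of "t i"] t(2) that d[OF that]
    by (simp add: power_mult[symmetric])
  then show "U \<in> box (\<lambda>i (z::'k). z ^ d i = 1)" unfolding box_def t(1) using t(2) by auto
qed

end

theorem theorem7p1:
  fixes n r :: nat
    and \<Sigma> :: "real vec set set"
    and \<Phi> \<beta> A B C :: "int mat"
    and L :: "int vec set"
    and d :: "nat \<Rightarrow> nat"
  assumes fan: "complete_simplicial_fan n \<Sigma>"
    and Phi_dim: "\<Phi> \<in> carrier_mat r n"
    and rays: "primitive_ray_generators \<Phi> \<Sigma>"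
    and beta_dim: "\<beta> \<in> carrier_mat (r - n) r"
    and exact: "short_exact \<Phi> \<beta>"
    and L_sub: "L \<subseteq> int_image \<Phi>"
    and B_dim: "B \<in> carrier_mat r n"
    and B_basis: "lattice_basis B L"
    and A_dim: "A \<in> carrier_mat r r" and A_unimodular: "invertible_mat A"
    and C_dim: "C \<in> carrier_mat n n" and C_unimodular: "invertible_mat C"
    and smith: "A * B * C = mat r n (\<lambda>(i, j). if i = j then int (d j) else 0)"
    and d_pos: "\<And>i. i < n \<Longrightarrow> 0 < d i"
    and d_dvd: "\<And>i. Suc i < n \<Longrightarrow> d i dvd d (Suc i)"
  shows
    "(\<forall>\<eta> :: nat \<Rightarrow> 'k::field.
        (\<forall>i < n. generates_roots_of_unity (d i) (\<eta> i)) \<longrightarrow>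
        (\<forall>i < n. cox_orbit \<Phi> (vec r (\<lambda>j. \<eta> i powi A $$ (i, j)))
           \<in> carrier (variety_torus \<Phi> TYPE('k))) \<and>
        internal_direct_product (variety_torus \<Phi> TYPE('k))
          (variety_zeros \<Phi> \<Sigma> \<beta> (lattice_ideal r L :: 'k cox_poly set))
          {..<n}
          (\<lambda>i. generate (variety_torus \<Phi> TYPE('k))
                 {cox_orbit \<Phi> (vec r (\<lambda>j. \<eta> i powi A $$ (i, j)))}))
     \<and>
     (finite (UNIV :: 'k set) \<longrightarrow>
      (\<forall>i < n. d i dvd card (UNIV :: 'k set) - 1) \<longrightarrow>
      variety_zeros \<Phi> \<Sigma> \<beta> (lattice_ideal r L :: 'k cox_poly set) =
      parametrized_set \<Phi> (mat n r (\<lambda>(i, j). int ((card (UNIV :: 'k set) - 1) div d i) * A $$ (i, j))))"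
proof -
  have saturated: "int_image \<Phi> = mat_kernel \<beta>" using exact by (simp add: short_exact_def)
  obtain W where basis: "n \<le> r" "W \<in> carrier_mat r n" "int_image \<Phi> = int_image W"
    "L = int_image (mat r n (\<lambda>(i, j). int (d j) * W $$ (i, j)))"
    "\<And>i k. i < n \<Longrightarrow> k < n \<Longrightarrow> row A i \<bullet> col W k = (if i = k then 1 else 0)"
    by (rule smith_dual_basis[OF Phi_dim beta_dim saturated L_sub B_dim B_basis A_dim A_unimodular
        C_dim C_unimodular smith d_pos]) (assumption, rule that)
  interpret torus_coordinates \<Phi> W A r n
    by unfold_locales (use basis Phi_dim A_dim in auto)
  have L_eq: "L = int_image B" and B_ker: "mat_kernel B = {0\<^sub>v n}"
    using B_basis B_dim by (auto simp: lattice_basis_def)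
  obtain k where k: "0 < k" "\<And>m. m \<in> int_image \<Phi> \<Longrightarrow> k \<cdot>\<^sub>v m \<in> int_image B"
    by (rule multiple_in_full_rank_sublattice[OF Phi_dim B_dim B_ker L_sub[unfolded L_eq]]) (rule that)
  have zeros: "variety_zeros \<Phi> \<Sigma> \<beta> (lattice_ideal r L :: 'k cox_poly set) =
      box (\<lambda>i z. z ^ d i = 1)"
    using k by (intro trans[OF variety_zeros_lattice_ideal[OF Phi_dim fan rays beta_dim
        L_sub[unfolded saturated]] lattice_orbits_eq_box[OF basis(4)]]) (simp_all add: L_eq)
  show ?thesis
  proof (intro conjI allI impI)
    fix \<eta> :: "nat \<Rightarrow> 'k" and i
    assume \<eta>: "\<forall>i < n. generates_roots_of_unity (d i) (\<eta> i)"
    show "cox_orbit \<Phi> (vec r (\<lambda>j. \<eta> i powi A $$ (i, j))) \<in> carrier (variety_torus \<Phi> TYPE('k))"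
      if "i < n"
    proof -
      have "\<eta> i ^ d i = 1" using \<eta> that by (intro generates_roots_of_unity_power) simp
      then have "\<eta> i \<noteq> 0" using d_pos[OF that] by (auto simp: power_0_left)
      then show ?thesis
        unfolding axis_eq_cox_orbit[OF that, symmetric] axis_def carrier_torus
        by (intro CollectI exI[of _ "\<lambda>k. if k = i then \<eta> i else 1"]) simp
    qed
  next
    fix \<eta> :: "nat \<Rightarrow> 'k"
    assume \<eta>: "\<forall>i < n. generates_roots_of_unity (d i) (\<eta> i)"
    have "internal_direct_product (variety_torus \<Phi> TYPE('k)) (box (\<lambda>i z. z ^ d i = 1)) {..<n}
           (\<lambda>i. generate (variety_torus \<Phi> TYPE('k)) {axis i (\<eta> i)})"
      by (rule internal_direct_product_box) (use d_pos \<eta> in auto)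
    then show "internal_direct_product (variety_torus \<Phi> TYPE('k))
          (variety_zeros \<Phi> \<Sigma> \<beta> (lattice_ideal r L :: 'k cox_poly set)) {..<n}
          (\<lambda>i. generate (variety_torus \<Phi> TYPE('k))
                 {cox_orbit \<Phi> (vec r (\<lambda>j. \<eta> i powi A $$ (i, j)))})"
      unfolding zeros by (rule internal_direct_product_cong) (simp add: axis_eq_cox_orbit)
  next
    assume "finite (UNIV :: 'k set)" "\<forall>i < n. d i dvd card (UNIV :: 'k set) - 1"
    then show "variety_zeros \<Phi> \<Sigma> \<beta> (lattice_ideal r L :: 'k cox_poly set) =
      parametrized_set \<Phi> (mat n r (\<lambda>(i, j). int ((card (UNIV :: 'k set) - 1) div d i) * A $$ (i, j)))"
      unfolding zeros by (intro box_eq_parametrized_set) auto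
  qed
qed

end
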